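(* Let $G$ be a graph of maximum degree $3$ (parallel edges allowed) which does not contain $H_1$ or $H_2$ as a subgraph. Then $\chi_c'(G) \leq 11/3$.
   Context: Graphs are finite, may have parallel edges, but have no loops. $K_2^3$ denotes the graph with two vertices joined by three parallel edges. $H_1$ is the graph obtained from $K_2^3$ by subdividing one edge (replacing one edge $uv$ by a path $u,w,v$ through a new vertex $w$). $H_2$ is the graph obtained from the complete graph $K_4$ by subdividing one edge in the same way. For positive integers $p \geq q$, a $(p,q)$-coloring of a graph $G=(V,E)$ is a mapping $f: V \to \{0,1,\ldots,p-1\}$ such that for every edge $xy$ of $G$, $q \leq |f(x)-f(y)| \leq p-q$. The circular chromatic number of $G$ is $\chi_c(G) = \inf\{p/q : G \text{ has a } (p,q)\text{-coloring}\}$. The line graph $L(G)$ of $G$ has vertex set $E$, two distinct elements $e_1,e_2 \in E$ being adjacent if they have an end vertex in common (in particular, parallel edges are distinct adjacent vertices of $L(G)$). The circular chromatic index of $G$ is $\chi_c'(G) = \chi_c(L(G))$. *)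

theory Defs
  imports Complex_Main
begin

text \<open>Parallel edges are distinct elements of the edge set with the same set of two ends.\<close>

record ('v, 'e) mgraph =
  vertices :: "'v set"
  edge_set :: "'e set"
  ends :: "'e \<Rightarrow> 'v set"

locale multigraph =
  fixes G :: "('v, 'e) mgraph"
  assumes finite_vertices: "finite (vertices G)"
    and finite_edge_set: "finite (edge_set G)"
    and ends_subset: "e \<in> edge_set G \<Longrightarrow> ends G e \<subseteq> vertices G"
    and card_ends: "e \<in> edge_set G \<Longrightarrow> card (ends G e) = 2"

definition vertex_degree :: "('v, 'e) mgraph \<Rightarrow> 'v \<Rightarrow> nat" where
  "vertex_degree G v = card {e \<in> edge_set G. v \<in> ends G e}"

text \<open>On type \<^typ>\<open>nat\<close> the supremum of a nonempty finite set is its maximum,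
  and that of the empty set is 0.\<close>

definition max_degree :: "('v, 'e) mgraph \<Rightarrow> nat" where
  "max_degree G = (SUP v\<in>vertices G. vertex_degree G v)"


definition is_subgraph :: "('v, 'e) mgraph \<Rightarrow> ('v, 'e) mgraph \<Rightarrow> bool" where
  "is_subgraph S G \<longleftrightarrow> multigraph S \<and> vertices S \<subseteq> vertices G \<and> edge_set S \<subseteq> edge_set G \<and>
     (\<forall>e\<in>edge_set S. ends S e = ends G e)"

definition isomorphic :: "('v, 'e) mgraph \<Rightarrow> ('w, 'f) mgraph \<Rightarrow> bool" where
  "isomorphic G H \<longleftrightarrow> (\<exists>\<phi> \<psi>. bij_betw \<phi> (vertices G) (vertices H) \<and>
     bij_betw \<psi> (edge_set G) (edge_set H) \<and>
     (\<forall>e\<in>edge_set G. ends H (\<psi> e) = \<phi> ` ends G e))"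

definition contains_subgraph :: "('v, 'e) mgraph \<Rightarrow> ('w, 'f) mgraph \<Rightarrow> bool" where
  "contains_subgraph G H \<longleftrightarrow> (\<exists>S. is_subgraph S G \<and> isomorphic S H)"


text \<open>The edge \<open>e\<close> is replaced by a path through the new vertex \<^const>\<open>None\<close>;
  for each end \<open>u\<close> of \<open>e\<close>, the edge \<open>Inr u\<close> of that path joins \<open>u\<close> to the new vertex.\<close>

definition subdivide :: "('v, 'e) mgraph \<Rightarrow> 'e \<Rightarrow> ('v option, 'e + 'v) mgraph" where
  "subdivide G e = \<lparr>vertices = insert None (Some ` vertices G),
     edge_set = Inl ` (edge_set G - {e}) \<union> Inr ` ends G e,
     ends = (\<lambda>x. case x of Inl d \<Rightarrow> Some ` ends G d | Inr u \<Rightarrow> {Some u, None})\<rparr>"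

definition K23 :: "(nat, nat) mgraph" where
  "K23 = \<lparr>vertices = {0, 1}, edge_set = {0, 1, 2}, ends = (\<lambda>_. {0, 1})\<rparr>"

definition K4 :: "(nat, nat set) mgraph" where
  "K4 = \<lparr>vertices = {0, 1, 2, 3}, edge_set = {e. e \<subseteq> {0, 1, 2, 3} \<and> card e = 2}, ends = (\<lambda>e. e)\<rparr>"

text \<open>The automorphism groups of \<^const>\<open>K23\<close> and \<^const>\<open>K4\<close> act transitively on edges, so the
  choice of the subdivided edge is immaterial up to isomorphism.\<close>

definition H1 :: "(nat option, nat + nat) mgraph" where
  "H1 = subdivide K23 0"

definition H2 :: "(nat option, nat set + nat) mgraph" where
  "H2 = subdivide K4 {0, 1}"


definition pq_coloring :: "('v, 'e) mgraph \<Rightarrow> nat \<Rightarrow> nat \<Rightarrow> ('v \<Rightarrow> nat) \<Rightarrow> bool" where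
  "pq_coloring G p q f \<longleftrightarrow> (\<forall>v\<in>vertices G. f v \<in> {0..<p}) \<and>
     (\<forall>e\<in>edge_set G. \<forall>x y. ends G e = {x, y} \<longrightarrow>
        int q \<le> \<bar>int (f x) - int (f y)\<bar> \<and> \<bar>int (f x) - int (f y)\<bar> \<le> int p - int q)"

definition circular_chromatic_number :: "('v, 'e) mgraph \<Rightarrow> real" where
  "circular_chromatic_number G =
     Inf {real p / real q | p q. 0 < q \<and> q \<le> p \<and> (\<exists>f. pq_coloring G p q f)}"

definition line_graph :: "('v, 'e) mgraph \<Rightarrow> ('e, 'e set) mgraph" where
  "line_graph G = \<lparr>vertices = edge_set G,
     edge_set = {{e1, e2} | e1 e2. e1 \<in> edge_set G \<and> e2 \<in> edge_set G \<and> e1 \<noteq> e2 \<and>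
       ends G e1 \<inter> ends G e2 \<noteq> {}},
     ends = (\<lambda>a. a)\<rparr>"

definition circular_chromatic_index :: "('v, 'e) mgraph \<Rightarrow> real" where
  "circular_chromatic_index G = circular_chromatic_number (line_graph G)"

end

(* Colours live in Z/11, two of them being compatible if their circular distance is at least 3. An edge
   cut of size 1 is harmless: colour both sides and rotate one of them. Otherwise, contracting triangles
   and applying the Tutte-Berge formula gives a matching M that covers all vertices of degree 3 and
   meets every triangle, up to those in a component H1; so the rest consists of paths and cycles, and
   the odd cycles have length at least 5. If the colours on M are taken from {0, 1, 2}, the two colours
   5 and 8 can always be alternated on paths and even cycles. An odd cycle can be coloured as soon as
   four consecutive vertices see colours like 0, 0, >= 1, >= 1 or <= 1, <= 1, 2, 2 on M.

   To find such colours, every odd cycle chooses four consecutive vertices and labels them low, low,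
   high, high (or the reverse); an edge of M gets 0 or 2 if its labelled ends agree, and 1 otherwise.
   A choice that minimises the number of edges of M with opposite labels works: by minimality a cycle
   sees at most one such edge, unless all its partners carry the same label, and in both cases one of
   its two pairs is not opposed. The only cycle on which no choice is possible is a 5-cycle with two
   crossing chords, which is H2. *)

theory Submission
  imports Defs
begin

section \<open>Maximum matchings\<close>

text \<open>The colours compatible with each of 0, 1 and 2 are 5, 6, 7 and 8, and among these only 5
  and 8 are compatible with each other: hence the two alternating colours, and hence the trouble
  with odd cycles. It would not help to give all of \<open>M\<close> one of the colours 0, 1, 2: the
  colours left for the cycles would still have a bipartite compatibility graph, for 0 with the
  classes 3, 4, 5 and 6, 7, 8. So every odd cycle has to see two different colours on
  \<open>M\<close>, but \<open>M\<close> joins the cycles to each other and their demands compete.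
  What makes this solvable is slack: only one half of a window must show the extreme colour 0 or 2,
  whereas the other half tolerates 1, the colour of an edge whose ends disagree. So each cycle can
  afford to lose one half of its window. Triangles must be met by \<open>M\<close> because a window
  takes four different vertices. Cuts of size 1 are removed beforehand because the matching rests on
  Petersen's count: an odd set of vertices of degree 3 has an odd cut, which must then have at least
  3 edges.\<close>

lemma even_card_involution:
  assumes "finite A" "\<And>u. u \<in> A \<Longrightarrow> p u \<in> A \<and> p (p u) = u \<and> p u \<noteq> u"
  shows "even (card A)"
  using assms
proof (induction "card A" arbitrary: A rule: less_induct)
  case less
  show ?case
  proof (cases "A = {}")
    case False
    then obtain u where u: "u \<in> A" by blast
    let ?B = "A - {u, p u}"
    have pu: "p u \<in> A" "p (p u) = u" "p u \<noteq> u" using less.prems(2)[OF u] by auto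
    have "card {u, p u} = 2" using pu(3) by simp
    moreover have "{u, p u} \<subseteq> A" using u pu(1) by simp
    ultimately have c: "card ?B + 2 = card A"
      using less.prems(1) by (metis card_Diff_subset card_mono finite_subset le_add_diff_inverse2)
    have "even (card ?B)"
    proof (rule less.hyps)
      show "card ?B < card A" using c by simp
      show "finite ?B" using less.prems(1) by simp
      fix w assume w: "w \<in> ?B"
      then have "p w \<in> A" "p (p w) = w" "p w \<noteq> w" using less.prems(2) by auto
      moreover have "p w \<noteq> u" "p w \<noteq> p u" using w pu \<open>p (p w) = w\<close> by force+
      ultimately show "p w \<in> ?B \<and> p (p w) = w \<and> p w \<noteq> w" by blast
    qed
    then show ?thesis using c by (metis even_add even_numeral)
  qed simp
qed

text \<open>A matching is encoded by the involution that swaps the ends of its edges; the fixed points are the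
  uncovered vertices.\<close>

definition matching_involution :: "('a \<Rightarrow> 'a \<Rightarrow> bool) \<Rightarrow> 'a set \<Rightarrow> ('a \<Rightarrow> 'a) \<Rightarrow> bool" where
  "matching_involution adj V p \<longleftrightarrow>
     (\<forall>u. p (p u) = u) \<and> (\<forall>u. p u \<noteq> u \<longrightarrow> u \<in> V \<and> adj u (p u))"

definition missed :: "'a set \<Rightarrow> ('a \<Rightarrow> 'a) \<Rightarrow> 'a set" where
  "missed V p = {u \<in> V. p u = u}"

definition maximum_matching :: "('a \<Rightarrow> 'a \<Rightarrow> bool) \<Rightarrow> 'a set \<Rightarrow> ('a \<Rightarrow> 'a) \<Rightarrow> bool" where
  "maximum_matching adj V p \<longleftrightarrow> matching_involution adj V p \<and>
     (\<forall>q. matching_involution adj V q \<longrightarrow> card (missed V p) \<le> card (missed V q))"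

lemma maximum_matching_exists: "\<exists>p. maximum_matching adj V p"
proof -
  have "matching_involution adj V id" by (simp add: matching_involution_def)
  then show ?thesis
    unfolding maximum_matching_def
    using ex_has_least_nat[of "matching_involution adj V" id "\<lambda>p. card (missed V p)"] by blast
qed

lemma matching_involution_closed:
  assumes "matching_involution adj V p" "u \<in> V" shows "p u \<in> V"
  using assms unfolding matching_involution_def by metis

lemma even_card_matched:
  assumes "finite V" "matching_involution adj V p"
  shows "even (card V - card (missed V p))" "card (missed V p) \<le> card V"
proof -
  have "even (card (V - missed V p))"
  proof (rule even_card_involution[where p = p])
    show "finite (V - missed V p)" using assms by simp
    fix u assume "u \<in> V - missed V p"
    then show "p u \<in> V - missed V p \<and> p (p u) = u \<and> p u \<noteq> u"
      using assms(2) matching_involution_closed[OF assms(2)]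
      unfolding missed_def matching_involution_def by auto
  qed
  moreover have sub: "missed V p \<subseteq> V" by (auto simp: missed_def)
  ultimately show "even (card V - card (missed V p))"
    using assms(1) by (simp add: card_Diff_subset finite_subset)
  show "card (missed V p) \<le> card V" using sub assms(1) by (rule card_mono[rotated])
qed

text \<open>Otherwise the edge between \<open>u\<close> and \<open>w\<close> could be added to the
  matching.\<close>

lemma maximum_matching_not_adjacent_missed:
  assumes "finite V" "symp adj" "irreflp adj" "maximum_matching adj V p" "u \<in> missed V p" "w \<in> missed V p"
  shows "\<not> adj u w"
proof
  assume a: "adj u w"
  have uw: "u \<noteq> w" using a assms(3) by (auto simp: irreflp_def)
  have p: "\<And>x. p (p x) = x" "\<And>x. p x \<noteq> x \<Longrightarrow> x \<in> V \<and> adj x (p x)"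
    using assms(4) by (auto simp: maximum_matching_def matching_involution_def)
  have f: "p u = u" "p w = w" "u \<in> V" "w \<in> V" using assms by (auto simp: missed_def)
  let ?q = "p(u := w, w := u)"
  have "matching_involution adj V ?q"
    unfolding matching_involution_def
  proof (intro conjI allI impI)
    fix x show "?q (?q x) = x" using p(1)[of x] p(1)[of u] p(1)[of w] f uw by (auto simp: fun_upd_def)
  next
    fix x assume "?q x \<noteq> x"
    then show "x \<in> V" using p(2)[of x] f by (auto split: if_splits)
  next
    fix x assume "?q x \<noteq> x"
    then show "adj x (?q x)" using p(2)[of x] f a assms(2) uw by (auto dest: sympD split: if_splits)
  qed
  then have "card (missed V p) \<le> card (missed V ?q)" using assms(4) by (auto simp: maximum_matching_def)
  moreover have "missed V ?q \<subseteq> missed V p - {u}" using uw by (auto simp: missed_def)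
  then have "card (missed V ?q) < card (missed V p)"
    using assms(1,5) by (metis (no_types, lifting) card_Diff1_less card_mono finite_Diff finite_subset le_less_trans missed_def mem_Collect_eq subsetI)
  ultimately show False by simp
qed

text \<open>Gallai's argument: take a maximum matching \<open>q\<close> missing \<open>t\<close> that agrees with \<open>p\<close> as often
  as possible, and switch it along one edge of \<open>p\<close>.\<close>

lemma never_both_missed_trans:
  assumes fin: "finite V" and sym: "symp adj" and irr: "irreflp adj"
    and ut: "\<And>p. maximum_matching adj V p \<Longrightarrow> \<not> (u \<in> missed V p \<and> t \<in> missed V p)"
    and tv: "\<And>p. maximum_matching adj V p \<Longrightarrow> \<not> (t \<in> missed V p \<and> v \<in> missed V p)"
    and uv: "u \<noteq> v" and t: "\<exists>q. maximum_matching adj V q \<and> t \<in> missed V q"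
    and p: "maximum_matching adj V p"
  shows "\<not> (u \<in> missed V p \<and> v \<in> missed V p)"
proof
  assume mp: "u \<in> missed V p \<and> v \<in> missed V p"
  define agree where "agree q = {x. p x = q x \<and> p x \<noteq> x}" for q
  have pinv: "\<And>x. p (p x) = x" "\<And>x. p x \<noteq> x \<Longrightarrow> x \<in> V \<and> adj x (p x)"
    using p by (auto simp: maximum_matching_def matching_involution_def)
  have agV: "agree q \<subseteq> V" for q using pinv(2) by (auto simp: agree_def)
  define P where "P q \<longleftrightarrow> maximum_matching adj V q \<and> t \<in> missed V q" for q
  have "\<exists>q. P q \<and> (\<forall>q'. P q' \<longrightarrow> card (agree q') \<le> card (agree q))"
  proof -
    obtain q0 where "P q0" using t P_def by blast
    moreover have "\<forall>q. P q \<longrightarrow> card (agree q) < Suc (card V)"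
      using agV fin by (simp add: card_mono less_Suc_eq_le)
    ultimately show ?thesis using ex_has_greatest_nat[of P q0 "\<lambda>q. card (agree q)" "Suc (card V)"] by blast
  qed
  then obtain q where q: "maximum_matching adj V q" "t \<in> missed V q"
    and best: "\<And>q'. maximum_matching adj V q' \<Longrightarrow> t \<in> missed V q' \<Longrightarrow> card (agree q') \<le> card (agree q)"
    unfolding P_def by blast
  have qinv: "\<And>x. q (q x) = x" "\<And>x. q x \<noteq> x \<Longrightarrow> x \<in> V \<and> adj x (q x)"
    using q(1) by (auto simp: maximum_matching_def matching_involution_def)
  have finm: "finite (missed V r)" for r using fin by (simp add: missed_def)
  have un: "u \<notin> missed V q" "v \<notin> missed V q" "t \<notin> missed V p"
    using ut[OF q(1)] tv[OF q(1)] ut[OF p] q(2) mp by blast+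
  have ceq: "card (missed V q) = card (missed V p)"
    using p q(1) unfolding maximum_matching_def by (meson le_antisym)
  \<comment> \<open>Both matchings miss equally many vertices, and \<open>p\<close> misses
    \<open>u\<close> and \<open>v\<close>, which \<open>q\<close> covers. So \<open>q\<close> misses
    at least two vertices that \<open>p\<close> covers, and one of them is not
    \<open>t\<close>.\<close>
  have "\<exists>x. x \<in> missed V q - missed V p \<and> x \<noteq> t"
  proof (rule ccontr)
    assume "\<nexists>x. x \<in> missed V q - missed V p \<and> x \<noteq> t"
    then have "missed V q \<subseteq> insert t (missed V p - {u, v})" using un by auto
    then have "card (missed V q) \<le> card (insert t (missed V p - {u, v}))"
      by (meson card_mono finite_insert finite_Diff finm)
    also have "\<dots> \<le> Suc (card (missed V p - {u, v}))" by (simp add: card_insert_if finm)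
    also have "card (missed V p - {u, v}) = card (missed V p) - 2"
      using mp uv by (simp add: card_Diff_subset finm)
    finally have "card (missed V q) \<le> Suc (card (missed V p) - 2)" .
    moreover have "card {u, v} \<le> card (missed V p)" using mp finm by (intro card_mono) auto
    ultimately show False using ceq uv by simp
  qed
  then obtain x where x: "x \<in> missed V q" "x \<notin> missed V p" "x \<noteq> t" by blast
  have xV: "x \<in> V" "q x = x" "p x \<noteq> x" using x by (auto simp: missed_def)
  define y where "y = p x"
  have y: "y \<in> V" "adj x y" "y \<noteq> x" "p y = x"
    using pinv xV y_def by (auto intro: matching_involution_closed p[unfolded maximum_matching_def, THEN conjunct1])
  have ynm: "q y \<noteq> y"
    using maximum_matching_not_adjacent_missed[OF fin sym irr q(1) x(1)] y by (auto simp: missed_def)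
  define z where "z = q y"
  have qz: "q z = y" using qinv(1) z_def by simp
  then have z: "z \<noteq> y" "q z = y" "z \<noteq> x" "z \<in> V"
    using ynm z_def xV(2) y(1,3) by (auto intro: matching_involution_closed q(1)[unfolded maximum_matching_def, THEN conjunct1])
  have ty: "t \<noteq> y" "t \<noteq> z" using q(2) ynm z by (auto simp: missed_def)
  \<comment> \<open>The edge of \<open>q\<close> between \<open>y\<close> and \<open>z\<close> is
    exchanged for the edge of \<open>p\<close> between \<open>x\<close> and \<open>y\<close>. The
    new matching misses \<open>z\<close> instead of \<open>x\<close>, so it is still maximum and
    still misses \<open>t\<close>; it agrees with \<open>p\<close> more often because the lost edge
    was not in \<open>p\<close>.\<close>
  let ?q = "q(x := y, y := x, z := z)"
  have qother: "q w \<noteq> x \<and> q w \<noteq> y \<and> q w \<noteq> z" if "w \<noteq> x" "w \<noteq> y" "w \<noteq> z" for w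
    using that qinv(1) xV(2) z(2) z_def by metis
  have mi: "matching_involution adj V ?q"
    unfolding matching_involution_def
  proof (intro conjI allI impI)
    fix w show "?q (?q w) = w"
      using y z qother[of w] qinv(1)[of w] by (cases "w = x"; cases "w = y"; cases "w = z") auto
  next
    fix w assume "?q w \<noteq> w"
    then show "w \<in> V" using qinv(2)[of w] xV y by (auto split: if_splits)
  next
    fix w assume "?q w \<noteq> w"
    then show "adj w (?q w)" using qinv(2)[of w] xV y z sym by (auto dest: sympD split: if_splits)
  qed
  have mq: "missed V ?q = insert z (missed V q - {x})"
    using xV y z ynm by (auto simp: missed_def)
  have "card (missed V ?q) = card (missed V q)"
  proof -
    have "z \<notin> missed V q - {x}" using z by (auto simp: missed_def)
    then show ?thesis using mq x(1) finm by (metis card.insert card.remove finite_Diff)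
  qed
  then have "maximum_matching adj V ?q" using q(1) mi by (auto simp: maximum_matching_def)
  moreover have "t \<in> missed V ?q" using mq q(2) x(3) by auto
  ultimately have "card (agree ?q) \<le> card (agree q)" by (rule best)
  moreover have "card (agree q) < card (agree ?q)"
  proof (rule psubset_card_mono)
    show "finite (agree ?q)" using agV fin finite_subset by blast
    have "x \<in> agree ?q" using xV y z y_def by (auto simp: agree_def)
    moreover have "x \<notin> agree q" using xV by (auto simp: agree_def)
    moreover have "agree q \<subseteq> agree ?q"
    proof
      fix w assume w: "w \<in> agree q"
      have "w \<noteq> x" using xV w by (auto simp: agree_def)
      moreover have "w \<noteq> y" using w y z z_def by (auto simp: agree_def)
      moreover have "w \<noteq> z"
      proof
        assume "w = z"
        then have "p z = y" using w z by (auto simp: agree_def)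
        then have "p (p z) = x" using y by simp
        then show False using pinv(1)[of z] z by simp
      qed
      ultimately show "w \<in> agree ?q" using w by (auto simp: agree_def)
    qed
    ultimately show "agree q \<subset> agree ?q" by blast
  qed
  ultimately show False by simp
qed

text \<open>This is the difficult inequality of the Tutte-Berge formula; the members of \<O> need
  not be connected, it is enough that no edge leaves them within \<open>V - S\<close>. A vertex
  covered by every maximum matching is deleted and put into \<open>S\<close>. If there is none,
  being equal or never missed together is an equivalence relation, and its classes serve as \<O>
  with \<open>S\<close> empty.\<close>

lemma tutte_berge:
  assumes "finite V" and sym: "symp adj" and irr: "irreflp adj"
  shows "\<exists>p S \<O>. matching_involution adj V p \<and> S \<subseteq> V \<and> (\<forall>K\<in>\<O>. K \<subseteq> V - S) \<and> pairwise disjnt \<O> \<and>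
    (\<forall>K\<in>\<O>. odd (card K) \<and> (\<forall>u\<in>K. \<forall>w\<in>V - S. adj u w \<longrightarrow> w \<in> K)) \<and>
    card (missed V p) + card S \<le> card \<O>"
  using assms(1)
proof (induction "card V" arbitrary: V rule: less_induct)
  case less
  note fin = less.prems
  show ?case
  proof (cases "\<exists>v\<in>V. \<forall>p. maximum_matching adj V p \<longrightarrow> v \<notin> missed V p")
    case True
    then obtain v where v: "v \<in> V" "\<And>p. maximum_matching adj V p \<Longrightarrow> v \<notin> missed V p" by blast
    have "card (V - {v}) < card V" using v(1) fin by (simp only: card_Diff1_less)
    from less.hyps[OF this] fin obtain q S \<O> where
      q: "matching_involution adj (V - {v}) q" and S: "S \<subseteq> V - {v}"
      and sub: "\<forall>K\<in>\<O>. K \<subseteq> V - {v} - S" and disj: "pairwise disjnt \<O>"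
      and odd: "\<forall>K\<in>\<O>. odd (card K) \<and> (\<forall>u\<in>K. \<forall>w\<in>V - {v} - S. adj u w \<longrightarrow> w \<in> K)"
      and le: "card (missed (V - {v}) q) + card S \<le> card \<O>" by auto
    obtain p where p: "maximum_matching adj V p" using maximum_matching_exists by blast
    have pm: "matching_involution adj V p" using p by (simp add: maximum_matching_def)
    have qV: "matching_involution adj V q" using q by (auto simp: matching_involution_def)
    have "q v = v" using q by (auto simp: matching_involution_def)
    then have mq: "missed V q = insert v (missed (V - {v}) q)" using v(1) by (auto simp: missed_def)
    then have "v \<in> missed V q" by simp
    \<comment> \<open>As a matching of \<open>V\<close>, \<open>q\<close> misses \<open>v\<close>,
      so it is not maximum. Both numbers of missed vertices have the parity of
      \<open>card V\<close>, so \<open>p\<close> misses at least two vertices fewer. One of the two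
      accounts for \<open>v\<close> itself, the other pays for \<open>v\<close> joining
      \<open>S\<close>.\<close>
    then have "\<not> maximum_matching adj V q" using v(2) by blast
    then obtain r where r: "matching_involution adj V r" "card (missed V r) < card (missed V q)"
      using qV by (auto simp: maximum_matching_def)
    then have lt: "card (missed V p) < card (missed V q)"
      using p by (meson le_less_trans maximum_matching_def)
    have mq': "card (missed V q) = Suc (card (missed (V - {v}) q))"
      using mq fin by (simp add: missed_def)
    have "card V - card (missed V p) = (card V - card (missed V q)) + (card (missed V q) - card (missed V p))"
      using lt even_card_matched(2)[OF fin qV] by simp
    then have "even (card (missed V q) - card (missed V p))"
      using even_card_matched(1)[OF fin pm] even_card_matched(1)[OF fin qV] by (metis even_add)
    then have "card (missed V q) - card (missed V p) \<noteq> 1" by (metis odd_one)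
    then have "card (missed V p) + 1 \<le> card (missed (V - {v}) q)" using lt mq' by linarith
    moreover have "card (insert v S) = Suc (card S)"
    proof (intro card_insert_disjoint)
      show "finite S" using S fin by (meson finite_Diff finite_subset)
      show "v \<notin> S" using S by blast
    qed
    ultimately have "card (missed V p) + card (insert v S) \<le> card \<O>" using le by simp
    moreover have "V - {v} - S = V - insert v S" by blast
    moreover have "insert v S \<subseteq> V" using S v(1) by blast
    ultimately have "matching_involution adj V p \<and> insert v S \<subseteq> V \<and> (\<forall>K\<in>\<O>. K \<subseteq> V - insert v S) \<and>
      pairwise disjnt \<O> \<and> (\<forall>K\<in>\<O>. odd (card K) \<and> (\<forall>u\<in>K. \<forall>w\<in>V - insert v S. adj u w \<longrightarrow> w \<in> K)) \<and>
      card (missed V p) + card (insert v S) \<le> card \<O>"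
      using pm sub disj odd by simp
    then show ?thesis by (intro exI)
  next
    case False
    then have all: "\<And>v. v \<in> V \<Longrightarrow> \<exists>p. maximum_matching adj V p \<and> v \<in> missed V p" by blast
    define R where "R u v \<longleftrightarrow> u = v \<or> (\<forall>p. maximum_matching adj V p \<longrightarrow> \<not> (u \<in> missed V p \<and> v \<in> missed V p))" for u v
    have Rsym: "R u v \<Longrightarrow> R v u" for u v by (auto simp: R_def)
    have Rtrans: "R u v" if "R u t" "R t v" "t \<in> V" for u t v
      using never_both_missed_trans[OF fin sym irr, of u t v] that all[of t] unfolding R_def by metis
    have Radj: "R u w" if "adj u w" for u w
      using maximum_matching_not_adjacent_missed[OF fin sym irr] that unfolding R_def by blast
    define cl where "cl u = {w \<in> V. R u w}" for u
    have cl_eq: "cl u = cl w" if "w \<in> cl u" "u \<in> V" for u w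
      using that Rtrans Rsym unfolding cl_def by blast
    have cl_self: "u \<in> V \<Longrightarrow> u \<in> cl u" for u by (simp add: cl_def R_def)
    obtain p where p: "maximum_matching adj V p" using maximum_matching_exists by blast
    have pm: "matching_involution adj V p" using p by (simp add: maximum_matching_def)
    \<comment> \<open>A maximum matching missing \<open>u\<close> covers the rest of the class of
      \<open>u\<close> and pairs it off within itself, because adjacent vertices are
      related.\<close>
    have "odd (card (cl u))" if u: "u \<in> V" for u
    proof -
      obtain q where q: "maximum_matching adj V q" "u \<in> missed V q" using all[OF u] by blast
      have qm: "matching_involution adj V q" using q by (simp add: maximum_matching_def)
      have "even (card (cl u - {u}))"
      proof (rule even_card_involution[where p = q])
        show "finite (cl u - {u})" using fin by (simp add: cl_def)
        fix w assume w: "w \<in> cl u - {u}"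
        then have wV: "w \<in> V" and Ruw: "R u w" by (auto simp: cl_def)
        have "w \<notin> missed V q" using Ruw w q by (auto simp: R_def)
        then have n: "q w \<noteq> w" using wV by (simp add: missed_def)
        moreover have "q (q w) = w" "adj w (q w)" using qm n by (auto simp: matching_involution_def)
        moreover have "q w \<in> V" using matching_involution_closed[OF qm wV] .
        moreover have "R u (q w)" using Rtrans[OF Ruw Radj wV] \<open>adj w (q w)\<close> by blast
        moreover have "q w \<noteq> u" using \<open>q (q w) = w\<close> n q(2) by (auto simp: missed_def)
        ultimately show "q w \<in> cl u - {u} \<and> q (q w) = w \<and> q w \<noteq> w" by (simp add: cl_def)
      qed
      moreover have "card (cl u) = Suc (card (cl u - {u}))"
        using cl_self[OF u] fin by (intro card.remove) (auto simp: cl_def)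
      ultimately show ?thesis by simp
    qed
    moreover have "pairwise disjnt (cl ` V)"
      unfolding pairwise_def disjnt_def using cl_eq by (auto simp: cl_def) blast+
    \<comment> \<open>Two different vertices missed by \<open>p\<close> are not related, so they lie
      in different classes.\<close>
    moreover have "card (missed V p) \<le> card (cl ` V)"
    proof (rule card_inj_on_le[where f = cl])
      show "inj_on cl (missed V p)"
      proof (rule inj_onI)
        fix u w assume uw: "u \<in> missed V p" "w \<in> missed V p" "cl u = cl w"
        then have "w \<in> cl u" using cl_self by (auto simp: missed_def)
        then show "u = w" using uw p by (auto simp: cl_def R_def)
      qed
    qed (use fin in \<open>auto simp: missed_def\<close>)
    moreover have "\<forall>u\<in>K. \<forall>w\<in>V. adj u w \<longrightarrow> w \<in> K" if K: "K \<in> cl ` V" for K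
    proof (intro ballI impI)
      fix u w assume uw: "u \<in> K" "w \<in> V" "adj u w"
      obtain v where v: "K = cl v" "v \<in> V" using K by blast
      show "w \<in> K" using v uw Rtrans[of v u w] Radj[of u w] by (auto simp: cl_def)
    qed
    moreover have "\<forall>K\<in>cl ` V. K \<subseteq> V" by (auto simp: cl_def)
    ultimately have "matching_involution adj V p \<and> {} \<subseteq> V \<and> (\<forall>K\<in>cl ` V. K \<subseteq> V - {}) \<and>
      pairwise disjnt (cl ` V) \<and> (\<forall>K\<in>cl ` V. odd (card K) \<and> (\<forall>u\<in>K. \<forall>w\<in>V - {}. adj u w \<longrightarrow> w \<in> K)) \<and>
      card (missed V p) + card {} \<le> card (cl ` V)"
      using pm by simp
    then show ?thesis by (intro exI)
  qed
qed

section \<open>Matchings covering the vertices of degree 3\<close>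

text \<open>No vertex set is kept: isolated vertices do not matter for colouring edges, and deleting
  a bridge or contracting a triangle then changes only \<open>E\<close> and
  \<open>en\<close>.\<close>

locale subcubic =
  fixes E :: "'e set" and en :: "'e \<Rightarrow> 'v set"
  assumes finite_E: "finite E"
    and card_en: "e \<in> E \<Longrightarrow> card (en e) = 2"
    and degree_le: "card {e \<in> E. x \<in> en e} \<le> 3"
begin

definition cut :: "'v set \<Rightarrow> 'e set" where
  "cut A = {e \<in> E. card (en e \<inter> A) = 1}"

lemma finite_en: "e \<in> E \<Longrightarrow> finite (en e)"
  using card_en by (metis card.infinite zero_neq_numeral)

lemma ends_obtain:
  assumes "e \<in> E" obtains x y where "en e = {x, y}" "x \<noteq> y"
  using card_en[OF assms] by (auto simp: card_2_iff)

lemma other_end: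
  assumes "e \<in> E" "x \<in> en e" obtains y where "en e = {x, y}" "x \<noteq> y"
  using ends_obtain[OF assms(1)] assms(2) by (metis insert_commute insertE singletonD)

text \<open>An edge inside \<open>A\<close> contributes 2 to the degree sum; an edge of the cut
  contributes 1 to the degree sum and 1 to the size of the cut.\<close>

lemma even_degree_sum_plus_cut:
  assumes "finite A"
  shows "even ((\<Sum>x\<in>A. card {e \<in> E. x \<in> en e}) + card (cut A))"
proof -
  have "(\<Sum>x\<in>A. card {e \<in> E. x \<in> en e}) = (\<Sum>x\<in>A. \<Sum>e\<in>E. of_bool (x \<in> en e))"
    using finite_E by (intro sum.cong) (auto simp: of_bool_def sum.If_cases Int_def)
  also have "\<dots> = (\<Sum>e\<in>E. \<Sum>x\<in>A. of_bool (x \<in> en e))" by (rule sum.swap)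
  also have "\<dots> = (\<Sum>e\<in>E. card (en e \<inter> A))"
    using assms by (intro sum.cong) (auto simp: of_bool_def sum.If_cases Int_def conj_commute)
  finally have "(\<Sum>x\<in>A. card {e \<in> E. x \<in> en e}) = (\<Sum>e\<in>E. card (en e \<inter> A))" .
  moreover have "card (cut A) = (\<Sum>e\<in>E. of_bool (card (en e \<inter> A) = 1))"
    using finite_E by (auto simp: cut_def of_bool_def sum.If_cases Int_def)
  ultimately have "(\<Sum>x\<in>A. card {e \<in> E. x \<in> en e}) + card (cut A) =
      (\<Sum>e\<in>E. card (en e \<inter> A) + of_bool (card (en e \<inter> A) = 1))"
    by (simp add: sum.distrib)
  also have "even \<dots>"
  proof (rule dvd_sum)
    fix e assume e: "e \<in> E"
    have "card (en e \<inter> A) \<le> 2" using card_mono[OF finite_en[OF e], of "en e \<inter> A"] card_en[OF e] by simp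
    then consider "card (en e \<inter> A) = 0" | "card (en e \<inter> A) = 1" | "card (en e \<inter> A) = 2" by linarith
    then show "even (card (en e \<inter> A) + of_bool (card (en e \<inter> A) = 1))" by cases auto
  qed
  finally show ?thesis .
qed

definition cubic_vertices :: "'v set" where
  "cubic_vertices = {x. card {e \<in> E. x \<in> en e} = 3}"

definition matching :: "'e set \<Rightarrow> bool" where
  "matching M \<longleftrightarrow> M \<subseteq> E \<and> (\<forall>e\<in>M. \<forall>f\<in>M. e \<noteq> f \<longrightarrow> en e \<inter> en f = {})"

end

locale bridgeless_subcubic = subcubic +
  assumes no_bridge: "card (cut A) \<noteq> 1"
begin

text \<open>Joining all vertices that need not be covered to each other turns the claim into one on perfect
  matchings; the extra vertex \<^const>\<open>None\<close> makes the number of vertices even.\<close>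

lemma matching_covering_cubic_vertices:
  "\<exists>M. matching M \<and> cubic_vertices \<subseteq> (\<Union>e\<in>M. en e)"
proof -
  define V0 where "V0 = (\<Union>e\<in>E. en e)"
  define T where "T = cubic_vertices"
  define V where "V = Some ` V0 \<union> (if odd (card V0) then {None} else {})"
  define adj where "adj u w \<longleftrightarrow> u \<noteq> w \<and>
    ((\<exists>e\<in>E. \<exists>x y. en e = {x, y} \<and> u = Some x \<and> w = Some y) \<or> (u \<notin> Some ` T \<and> w \<notin> Some ` T))" for u w
  have finV0: "finite V0" using finite_E finite_en by (simp add: V0_def)
  have finV: "finite V" using finV0 by (simp add: V_def)
  have TV0: "T \<subseteq> V0"
  proof
    fix x assume "x \<in> T"
    then have "{e \<in> E. x \<in> en e} \<noteq> {}" by (auto simp: T_def cubic_vertices_def simp del: Collect_empty_eq)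
    then show "x \<in> V0" by (auto simp: V0_def)
  qed
  have evV: "even (card V)"
  proof -
    have "card (Some ` V0) = card V0" by (simp add: card_image)
    moreover have "None \<notin> Some ` V0" by blast
    ultimately show ?thesis using finV0 by (simp add: V_def)
  qed
  have sym: "symp adj" by (auto simp: symp_def adj_def insert_commute)
  have irr: "irreflp adj" by (simp add: irreflp_def adj_def)
  from tutte_berge[OF finV sym irr] obtain p S \<O> where
    tb: "matching_involution adj V p \<and> S \<subseteq> V \<and> (\<forall>K\<in>\<O>. K \<subseteq> V - S) \<and> pairwise disjnt \<O> \<and>
      (\<forall>K\<in>\<O>. odd (card K) \<and> (\<forall>u\<in>K. \<forall>w\<in>V - S. adj u w \<longrightarrow> w \<in> K)) \<and>
      card (missed V p) + card S \<le> card \<O>"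
    by (elim exE)
  then have pm: "matching_involution adj V p" and SV: "S \<subseteq> V" and disj: "pairwise disjnt \<O>"
    and le: "card (missed V p) + card S \<le> card \<O>" by simp_all
  have KV: "K \<subseteq> V - S" and oddK: "odd (card K)" if "K \<in> \<O>" for K
    using tb that by simp_all
  have closed: "w \<in> K" if "K \<in> \<O>" "u \<in> K" "w \<in> V - S" "adj u w" for K u w
    using tb that by simp
  have finO: "finite \<O>" using KV finV by (meson Diff_subset finite_Pow_iff finite_subset PowI subsetI subset_trans)
  have finS: "finite S" using SV finV by (rule finite_subset)
  define \<O>T where "\<O>T = {K \<in> \<O>. K \<subseteq> Some ` T}"
  \<comment> \<open>Vertices that need not be covered are pairwise adjacent, so two different
    members of \<O> cannot both contain one.\<close>
  have "card (\<O> - \<O>T) \<le> Suc 0"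
  proof (subst card_le_Suc0_iff_eq)
    show "finite (\<O> - \<O>T)" using finO by simp
    show "\<forall>K1\<in>\<O> - \<O>T. \<forall>K2\<in>\<O> - \<O>T. K1 = K2"
    proof (intro ballI, rule ccontr)
      fix K1 K2 assume K: "K1 \<in> \<O> - \<O>T" "K2 \<in> \<O> - \<O>T" "K1 \<noteq> K2"
      then obtain u1 u2 where u: "u1 \<in> K1" "u1 \<notin> Some ` T" "u2 \<in> K2" "u2 \<notin> Some ` T"
        by (auto simp: \<O>T_def)
      have dj: "K1 \<inter> K2 = {}" using disj K by (auto simp: pairwise_def disjnt_def)
      then have "adj u1 u2" using u by (auto simp: adj_def)
      then have "u2 \<in> K1" using closed[of K1 u1 u2] K u KV[of K2] by blast
      then show False using dj u by blast
    qed
  qed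
  \<comment> \<open>Petersen's count: a member of \<open>\<O>T\<close> consists of an odd number of
    vertices of degree 3, so its cut is odd and, not being 1, at least 3. All these cut edges end in
    \<open>S\<close>, which receives at most 3 per vertex and none at \<open>None\<close>.\<close>
  moreover have "card \<O>T \<le> card S"
  proof -
    define C where "C K = cut {x. Some x \<in> K}" for K
    have finC: "finite (C K)" for K using finite_E by (simp add: C_def cut_def)
    have toS: "\<exists>s\<in>S. s \<in> Some ` en e" if K: "K \<in> \<O>T" and e: "e \<in> C K" for K e
    proof -
      have eE: "e \<in> E" using e by (simp add: C_def cut_def)
      obtain x where x: "en e \<inter> {x. Some x \<in> K} = {x}" using e by (auto simp: C_def cut_def card_1_singleton_iff)
      then have xe: "x \<in> en e" "Some x \<in> K" by auto
      obtain y where y: "en e = {x, y}" "x \<noteq> y" using other_end[OF eE xe(1)] .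
      have yK: "Some y \<notin> K" using x y by auto
      have "adj (Some x) (Some y)" using y eE by (auto simp: adj_def)
      moreover have "Some y \<in> V" using y eE by (auto simp: V_def V0_def)
      ultimately have "Some y \<in> S" using closed[of K "Some x" "Some y"] K xe yK by (auto simp: \<O>T_def)
      then show ?thesis using y by auto
    qed
    have ge: "3 \<le> card (C K)" if K: "K \<in> \<O>T" for K
    proof -
      have KT: "K \<subseteq> Some ` T" and KO: "K \<in> \<O>" using K by (auto simp: \<O>T_def)
      define A where "A = {x. Some x \<in> K}"
      have KA: "K = Some ` A" using KT by (auto simp: A_def)
      have fA: "finite A"
        using KA KV[OF KO] finV by (metis finite_Diff finite_imageD finite_subset inj_Some)
      have "card A = card K" using KA by (simp add: card_image)
      then have "odd (card A)" using oddK[OF KO] by simp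
      have "(\<Sum>x\<in>A. card {e \<in> E. x \<in> en e}) = (\<Sum>x\<in>A. 3)"
        using KT by (intro sum.cong) (auto simp: A_def T_def cubic_vertices_def)
      then have "even (card A * 3 + card (cut A))" using even_degree_sum_plus_cut[OF fA] by simp
      then have "odd (card (cut A))" using \<open>odd (card A)\<close> by simp
      then have "card (cut A) \<noteq> 0" "card (cut A) \<noteq> 2" by (metis even_zero, metis even_numeral)
      then show ?thesis using no_bridge[of A] unfolding C_def A_def by linarith
    qed
    have "card \<O>T * 3 \<le> (\<Sum>K\<in>\<O>T. card (C K))" using ge sum_mono[of \<O>T "\<lambda>_. 3" "\<lambda>K. card (C K)"] by simp
    also have "\<dots> = card (\<Union>K\<in>\<O>T. C K)"
    proof (rule card_UN_disjoint[symmetric])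
      show "finite \<O>T" using finO by (simp add: \<O>T_def)
      show "\<forall>K\<in>\<O>T. finite (C K)" using finC by blast
      show "\<forall>K\<in>\<O>T. \<forall>L\<in>\<O>T. K \<noteq> L \<longrightarrow> C K \<inter> C L = {}"
      \<comment> \<open>An edge in two of the cuts would have its ends in two members of \<O>, hence
        none in \<open>S\<close>, contrary to \<open>toS\<close>.\<close>
      proof (intro ballI impI, rule ccontr)
        fix K L assume KL: "K \<in> \<O>T" "L \<in> \<O>T" "K \<noteq> L" "C K \<inter> C L \<noteq> {}"
        then obtain e where e: "e \<in> C K" "e \<in> C L" by blast
        have eE: "e \<in> E" using e by (simp add: C_def cut_def)
        obtain x where x: "en e \<inter> {x. Some x \<in> K} = {x}" using e by (auto simp: C_def cut_def card_1_singleton_iff)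
        obtain y where y: "en e \<inter> {x. Some x \<in> L} = {y}" using e by (auto simp: C_def cut_def card_1_singleton_iff)
        have "K \<inter> L = {}" using disj KL by (auto simp: pairwise_def disjnt_def \<O>T_def)
        then have "x \<noteq> y" using x y by blast
        then have "en e = {x, y}" using other_end[OF eE, of x] x y by blast
        moreover obtain s where s: "s \<in> S" "s \<in> Some ` en e" using toS[OF KL(1) e(1)] by blast
        moreover have "Some x \<in> K" "Some y \<in> L" using x y by auto
        moreover have "K \<subseteq> V - S" "L \<subseteq> V - S" using KV KL by (auto simp: \<O>T_def)
        ultimately show False by auto
      qed
    qed
    also have "\<dots> \<le> card (\<Union>s\<in>S. {e \<in> E. s \<in> Some ` en e})"
    proof (rule card_mono)
      show "finite (\<Union>s\<in>S. {e \<in> E. s \<in> Some ` en e})" using finite_E finS by simp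
      show "(\<Union>K\<in>\<O>T. C K) \<subseteq> (\<Union>s\<in>S. {e \<in> E. s \<in> Some ` en e})"
        using toS by (auto simp: C_def cut_def)
    qed
    also have "\<dots> \<le> (\<Sum>s\<in>S. card {e \<in> E. s \<in> Some ` en e})"
      using finS by (rule card_UN_le)
    also have "\<dots> \<le> (\<Sum>s\<in>S. 3)"
    proof (rule sum_mono)
      fix s assume "s \<in> S"
      show "card {e \<in> E. s \<in> Some ` en e} \<le> 3"
      proof (cases s)
        case (Some y)
        then have "{e \<in> E. s \<in> Some ` en e} = {e \<in> E. y \<in> en e}" by auto
        then show ?thesis using degree_le[of y] by simp
      next
        case None
        then have "{e \<in> E. s \<in> Some ` en e} = {}" by auto
        then show ?thesis by (simp only: card.empty)
      qed
    qed
    finally show ?thesis by simp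
  qed
  moreover have "card \<O> = card \<O>T + card (\<O> - \<O>T)"
    using finO card_Un_disjoint[of \<O>T "\<O> - \<O>T"] by (auto simp: \<O>T_def Un_absorb1 intro: arg_cong[where f = card])
  \<comment> \<open>A single missed vertex is then excluded by the parity of
    \<open>card V\<close>.\<close>
  ultimately have "card (missed V p) \<le> 1" using le by linarith
  moreover have "even (card (missed V p))"
    using even_card_matched[OF finV pm] evV by (metis even_diff_nat le_add_diff_inverse2 even_add)
  ultimately have "card (missed V p) = 0" by (metis le_antisym less_one linorder_not_le odd_one)
  then have perfect: "p u \<noteq> u" if "u \<in> V" for u
    using that finV by (auto simp: missed_def)
  have pinv: "p (p u) = u" and padj: "p u \<noteq> u \<Longrightarrow> adj u (p u)" for u
    using pm by (auto simp: matching_involution_def)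
  \<comment> \<open>The pairs of \<open>p\<close> that come only from the added adjacencies are
    dropped; they cover no vertex of \<open>T\<close>. Among parallel edges, \<open>ch\<close> picks
    one.\<close>
  define P where "P = {A. \<exists>x y. A = {x, y} \<and> p (Some x) = Some y \<and> (\<exists>e\<in>E. en e = A)}"
  define ch where "ch A = (SOME e. e \<in> E \<and> en e = A)" for A
  have ch: "ch A \<in> E \<and> en (ch A) = A" if "A \<in> P" for A
    unfolding ch_def by (rule someI_ex) (use that in \<open>auto simp: P_def\<close>)
  have disjP: "A \<inter> B = {}" if AB: "A \<in> P" "B \<in> P" "A \<noteq> B" for A B
  proof -
    obtain x y z w where "A = {x, y}" "p (Some x) = Some y" "B = {z, w}" "p (Some z) = Some w"
      using AB by (auto simp: P_def)
    then show ?thesis using AB(3) pinv[of "Some x"] pinv[of "Some z"] by auto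
  qed
  have "matching (ch ` P)"
    unfolding matching_def using ch disjP by (auto simp: disjoint_iff) blast+
  moreover have "T \<subseteq> (\<Union>e\<in>ch ` P. en e)"
  proof
    fix x assume x: "x \<in> T"
    then have "Some x \<in> V" using TV0 by (auto simp: V_def)
    from padj[OF perfect[OF this]] obtain e a b where
      "e \<in> E" "en e = {a, b}" "Some x = Some a" "p (Some x) = Some b" using x by (auto simp: adj_def)
    then have "{a, b} \<in> P" and "x = a" by (auto simp: P_def)
    then show "x \<in> (\<Union>e\<in>ch ` P. en e)" using ch by blast
  qed
  ultimately show ?thesis unfolding T_def by blast
qed

end

section \<open>Triangles\<close>

context subcubic
begin

text \<open>The triangles with two parallel edges are left out because no matching covering the vertices of
  degree 3 meets all the triangles of a component isomorphic to \<^const>\<open>H1\<close>.\<close>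

definition clean_triangle :: "'v set \<Rightarrow> bool" where
  "clean_triangle W \<longleftrightarrow> card W = 3 \<and> card {e \<in> E. en e \<subseteq> W} = 3 \<and>
     (\<forall>u\<in>W. \<forall>w\<in>W. u \<noteq> w \<longrightarrow> (\<exists>e\<in>E. en e = {u, w}))"

text \<open>Two of the at most three edges at \<open>u\<close> go to the other vertices of the
  triangle.\<close>

lemma outer_edge_unique:
  assumes W: "clean_triangle W" "u \<in> W"
    and e: "e \<in> E" "u \<in> en e" "\<not> en e \<subseteq> W" and f: "f \<in> E" "u \<in> en f" "\<not> en f \<subseteq> W"
  shows "e = f"
proof (rule ccontr)
  assume ef: "e \<noteq> f"
  obtain a b where ab: "W = {u, a, b}" "u \<noteq> a" "u \<noteq> b" "a \<noteq> b"
    using W by (auto simp: clean_triangle_def card_3_iff doubleton_eq_iff insert_commute)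
  obtain ea where ea: "ea \<in> E" "en ea = {u, a}" using W ab by (force simp: clean_triangle_def)
  obtain eb where eb: "eb \<in> E" "en eb = {u, b}" using W ab by (force simp: clean_triangle_def)
  have "ea \<noteq> eb" using ea eb ab by (auto simp: doubleton_eq_iff)
  moreover have "ea \<noteq> e" "ea \<noteq> f" "eb \<noteq> e" "eb \<noteq> f" using ea eb e f ab by auto
  ultimately have "card {ea, eb, e, f} = 4" using ef by simp
  moreover have "card {ea, eb, e, f} \<le> card {e \<in> E. u \<in> en e}"
    using finite_E ea eb e f by (intro card_mono) auto
  ultimately show False using degree_le[of u] by simp
qed

end

text \<open>The triangle shrinks to one of its own vertices and the edges keep their names, so the
  contraction has the same types and an induction on the number of edges applies to it.\<close>

locale triangle_contraction = bridgeless_subcubic +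
  fixes W :: "'b set" and a :: 'b
  assumes clean: "clean_triangle W" and aW: "a \<in> W"
begin

definition \<phi> :: "'b \<Rightarrow> 'b" where "\<phi> x = (if x \<in> W then a else x)"
definition E' :: "'a set" where "E' = {e \<in> E. \<not> en e \<subseteq> W}"
definition en' :: "'a \<Rightarrow> 'b set" where "en' e = \<phi> ` en e"

lemma mem_en'_outside: "x \<notin> W \<Longrightarrow> x \<in> en' e \<longleftrightarrow> x \<in> en e"
  using aW by (auto simp: en'_def \<phi>_def)

lemma mem_en'_inside: "x \<in> W \<Longrightarrow> x \<in> en' e \<longleftrightarrow> x = a \<and> en e \<inter> W \<noteq> {}"
  using aW by (auto simp: en'_def \<phi>_def image_iff)

lemma en'_same: "en e \<inter> W = {} \<Longrightarrow> en' e = en e"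
  by (force simp: en'_def \<phi>_def)

lemma finite_W: "finite W" and card_W: "card W = 3"
  using clean by (auto simp: clean_triangle_def intro: card_ge_0_finite)

lemma E'_end_unique:
  assumes "e \<in> E'" "x \<in> en e" "x \<in> W" "y \<in> en e" "y \<in> W" shows "x = y"
proof -
  have "e \<in> E" "\<not> en e \<subseteq> W" using assms by (auto simp: E'_def)
  then obtain z where "en e = {x, z}" using other_end[of e x] assms by metis
  then show ?thesis using assms \<open>\<not> en e \<subseteq> W\<close> by auto
qed

lemma inj_on_\<phi>: "e \<in> E' \<Longrightarrow> inj_on \<phi> (en e)"
  using E'_end_unique aW by (intro inj_onI) (metis \<phi>_def)

lemma outer_E'_unique:
  assumes "u \<in> W" "e \<in> E'" "u \<in> en e" "f \<in> E'" "u \<in> en f" shows "e = f"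
  using outer_edge_unique[OF clean] assms by (auto simp: E'_def)

text \<open>Each of the three vertices of \<open>W\<close> has at most one edge leaving
  \<open>W\<close>, which bounds the degree of \<open>a\<close>. A cut of the contraction is the cut
  of the preimage under \<phi>, since such a preimage contains all of \<open>W\<close> or nothing of
  it and so never cuts an edge inside \<open>W\<close>.\<close>

lemma bridgeless_contraction: "bridgeless_subcubic E' en'"
proof -
  have fin: "finite E'" using finite_E by (simp add: E'_def)
  have card2: "card (en' e) = 2" if "e \<in> E'" for e
    using that inj_on_\<phi>[OF that] card_en[of e] by (simp add: en'_def E'_def card_image)
  have deg: "card {e \<in> E'. x \<in> en' e} \<le> 3" for x
  proof (cases "x \<in> W")
    case False
    then have "{e \<in> E'. x \<in> en' e} \<subseteq> {e \<in> E. x \<in> en e}" by (auto simp: mem_en'_outside E'_def)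
    then have "card {e \<in> E'. x \<in> en' e} \<le> card {e \<in> E. x \<in> en e}"
      using finite_E by (intro card_mono) auto
    then show ?thesis using degree_le[of x] by linarith
  next
    case True
    have "{e \<in> E'. x \<in> en' e} \<subseteq> (\<Union>u\<in>W. {e \<in> E'. u \<in> en e})"
      using True by (auto simp: mem_en'_inside)
    then have "card {e \<in> E'. x \<in> en' e} \<le> card (\<Union>u\<in>W. {e \<in> E'. u \<in> en e})"
      using fin finite_W by (intro card_mono) auto
    also have "\<dots> \<le> (\<Sum>u\<in>W. card {e \<in> E'. u \<in> en e})" using finite_W by (rule card_UN_le)
    also have "\<dots> \<le> (\<Sum>u\<in>W. 1)"
    proof (rule sum_mono)
      fix u assume u: "u \<in> W"
      have "card {e \<in> E'. u \<in> en e} \<le> Suc 0"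
        using fin outer_E'_unique[OF u] by (subst card_le_Suc0_iff_eq) auto
      then show "card {e \<in> E'. u \<in> en e} \<le> 1" by simp
    qed
    finally show ?thesis using card_W by simp
  qed
  interpret C: subcubic E' en' by unfold_locales (use fin card2 deg in auto)
  have cut: "C.cut A = cut (\<phi> -` A)" for A
  proof -
    have 1: "card (en' e \<inter> A) = card (en e \<inter> \<phi> -` A)" if "e \<in> E'" for e
    proof -
      have "en' e \<inter> A = \<phi> ` (en e \<inter> \<phi> -` A)" by (auto simp: en'_def)
      moreover have "inj_on \<phi> (en e \<inter> \<phi> -` A)" using inj_on_\<phi>[OF that] by (rule inj_on_subset) blast
      ultimately show ?thesis by (simp add: card_image)
    qed
    have 2: "card (en e \<inter> \<phi> -` A) \<noteq> 1" if "e \<in> E" "en e \<subseteq> W" for e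
    proof -
      have "en e \<inter> \<phi> -` A = (if a \<in> A then en e else {})" using that by (auto simp: \<phi>_def)
      then show ?thesis using card_en[OF that(1)] by simp
    qed
    have "{e \<in> E'. card (en' e \<inter> A) = 1} = {e \<in> E'. card (en e \<inter> \<phi> -` A) = 1}"
      using 1 by (intro Collect_cong) auto
    also have "\<dots> = {e \<in> E. card (en e \<inter> \<phi> -` A) = 1}"
      using 2 unfolding E'_def by blast
    finally show ?thesis unfolding C.cut_def cut_def .
  qed
  show ?thesis by unfold_locales (use cut no_bridge in auto)
qed

sublocale C: bridgeless_subcubic E' en' by (rule bridgeless_contraction)

text \<open>\<open>M'\<close> touches \<open>W\<close> in at most one vertex \<open>x\<close>,
  because all its edges touching \<open>W\<close> end at \<open>a\<close> after the contraction.
  Adding the edge of the triangle opposite to \<open>x\<close> covers the other two vertices and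
  hits \<open>W\<close>. The delicate triangles are those that share an edge with
  \<open>W\<close>.\<close>

lemma lift_matching:
  assumes M': "C.matching M'" "C.cubic_vertices \<subseteq> (\<Union>e\<in>M'. en' e)"
    and tri': "\<And>T. C.clean_triangle T \<Longrightarrow> \<exists>e\<in>M'. en' e \<subseteq> T"
  shows "\<exists>M. matching M \<and> cubic_vertices \<subseteq> (\<Union>e\<in>M. en e) \<and>
    (\<forall>T. clean_triangle T \<longrightarrow> (\<exists>e\<in>M. en e \<subseteq> T))"
proof -
  have M'E: "M' \<subseteq> E'" using M'(1) by (simp add: C.matching_def)
  have E'E: "E' \<subseteq> E" by (auto simp: E'_def)
  have uniq: "e = f" if "e \<in> M'" "f \<in> M'" "en e \<inter> W \<noteq> {}" "en f \<inter> W \<noteq> {}" for e f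
  proof -
    have "a \<in> en' e \<inter> en' f" using that mem_en'_inside[OF aW] by blast
    then show ?thesis using that(1,2) M'(1) unfolding C.matching_def by blast
  qed
  \<comment> \<open>If \<open>M'\<close> leaves \<open>a\<close> uncovered, then \<open>a\<close>
    has degree at most 2 in the contraction, so some vertex of \<open>W\<close> has no edge leaving
    \<open>W\<close> and can serve as \<open>x\<close>.\<close>
  obtain x where x: "x \<in> W" and xalt: "(\<exists>e\<in>M'. x \<in> en e) \<or> (\<forall>e\<in>E'. x \<notin> en e)"
    and touch: "\<And>e u. e \<in> M' \<Longrightarrow> u \<in> en e \<Longrightarrow> u \<in> W \<Longrightarrow> u = x"
  proof (cases "\<exists>e\<in>M'. en e \<inter> W \<noteq> {}")
    case True
    then obtain e x where e: "e \<in> M'" "x \<in> en e" "x \<in> W" by blast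
    have "u = x" if "f \<in> M'" "u \<in> en f" "u \<in> W" for f u
    proof -
      have "f = e" using uniq[of f e] that e by blast
      then show ?thesis using E'_end_unique[of e u x] e that M'E by blast
    qed
    then show ?thesis using that e by blast
  next
    case False
    have "\<exists>x\<in>W. \<forall>e\<in>E'. x \<notin> en e"
    proof (rule ccontr)
      assume "\<not> (\<exists>x\<in>W. \<forall>e\<in>E'. x \<notin> en e)"
      then obtain g where g: "\<And>x. x \<in> W \<Longrightarrow> g x \<in> E' \<and> x \<in> en (g x)" by metis
      have "inj_on g W" using g E'_end_unique by (intro inj_onI) metis
      then have "card (g ` W) = 3" by (simp add: card_image card_W)
      moreover have "g ` W \<subseteq> {e \<in> E'. a \<in> en' e}" using g mem_en'_inside[OF aW] by blast
      then have "card (g ` W) \<le> card {e \<in> E'. a \<in> en' e}" using C.finite_E by (intro card_mono) auto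
      ultimately have "a \<in> C.cubic_vertices" using C.degree_le[of a] by (simp add: C.cubic_vertices_def)
      then show False using M'(2) False mem_en'_inside[OF aW] by blast
    qed
    then show ?thesis using that False by blast
  qed
  obtain y z where yz: "W = {x, y, z}" "x \<noteq> y" "x \<noteq> z" "y \<noteq> z"
    using x card_W by (auto simp: card_3_iff doubleton_eq_iff insert_commute)
  obtain g where g: "g \<in> E" "en g = {y, z}"
    using clean yz by (force simp: clean_triangle_def)
  have gW: "en g \<subseteq> W" unfolding yz(1) g(2) by blast
  have "matching (insert g M')"
    unfolding matching_def
  proof (intro conjI ballI impI)
    show "insert g M' \<subseteq> E" using M'E E'E g by blast
    have 1: "en e \<inter> en f = {}" if "e \<in> M'" "f \<in> M'" "e \<noteq> f" for e f
    proof -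
      have "\<phi> ` en e \<inter> \<phi> ` en f = {}" using that M'(1) by (simp add: C.matching_def en'_def)
      then show ?thesis by blast
    qed
    have 2: "en e \<inter> en g = {}" if "e \<in> M'" for e
      using touch[OF that] g yz by auto
    fix e f assume "e \<in> insert g M'" "f \<in> insert g M'" "e \<noteq> f"
    then show "en e \<inter> en f = {}" using 1 2 by blast
  qed
  moreover have "cubic_vertices \<subseteq> (\<Union>e\<in>insert g M'. en e)"
  proof
    fix v assume v: "v \<in> cubic_vertices"
    consider "v \<notin> W" | "v = x" | "v \<in> {y, z}" using yz by blast
    then show "v \<in> (\<Union>e\<in>insert g M'. en e)"
    proof cases
      case 1
      then have "{e \<in> E'. v \<in> en' e} = {e \<in> E. v \<in> en e}" by (auto simp: mem_en'_outside E'_def)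
      then have "v \<in> C.cubic_vertices" using v by (simp add: C.cubic_vertices_def cubic_vertices_def)
      then show ?thesis using M'(2) mem_en'_outside[OF 1] by blast
    next
      case 2
      \<comment> \<open>Without an edge leaving \<open>W\<close>, the vertex \<open>x\<close> has
        degree at most 2: a clean triangle spans only three edges, and \<open>g\<close> avoids
        \<open>x\<close>.\<close>
      have "\<exists>e\<in>M'. x \<in> en e"
      proof (rule ccontr)
        assume "\<not> (\<exists>e\<in>M'. x \<in> en e)"
        then have no: "\<forall>e\<in>E'. x \<notin> en e" using xalt by blast
        have "x \<notin> en g" using g yz by simp
        then have "{e \<in> E. x \<in> en e} \<subseteq> {e \<in> E. en e \<subseteq> W} - {g}"
          using no unfolding E'_def by blast
        then have "card {e \<in> E. x \<in> en e} \<le> card ({e \<in> E. en e \<subseteq> W} - {g})"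
          using finite_E by (intro card_mono) auto
        also have "\<dots> = card {e \<in> E. en e \<subseteq> W} - 1" using g(1) gW by (intro card_Diff_singleton) simp
        also have "\<dots> = 2" using clean by (simp add: clean_triangle_def)
        finally show False using v 2 by (simp add: cubic_vertices_def)
      qed
      then show ?thesis using 2 by blast
    qed (use g in auto)
  qed
  moreover have "\<exists>e\<in>insert g M'. en e \<subseteq> T" if T: "clean_triangle T" for T
  proof -
    have pairs: "\<exists>e\<in>E. en e = {u, w}" if "u \<in> T" "w \<in> T" "u \<noteq> w" for u w
      using T that by (simp add: clean_triangle_def)
    have cT: "card T = 3" "finite T" using T by (auto simp: clean_triangle_def intro: card_ge_0_finite)
    \<comment> \<open>If an edge leaves \<open>W\<close> at \<open>x\<close>, it is the only one
      there, so it must be the edge of \<open>M'\<close> at \<open>x\<close>.\<close>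
    have x_outer: "\<exists>e\<in>insert g M'. en e \<subseteq> T" if f: "f \<in> E" "en f = {x, d}" "d \<in> T" "d \<notin> W" "x \<in> T" for f d
    proof -
      have fE': "f \<in> E'" "x \<in> en f" using f by (auto simp: E'_def)
      then obtain e where e: "e \<in> M'" "x \<in> en e" using xalt by blast
      then have "e = f" using outer_E'_unique[OF x, of e f] fE' M'E by blast
      moreover have "en f \<subseteq> T" using f by simp
      ultimately show ?thesis using e(1) by blast
    qed
    consider "T \<inter> W = {}" | "T = W" | u d where "u \<in> T" "u \<in> W" "d \<in> T" "d \<notin> W"
      using cT card_W finite_W by (metis card_subset_eq disjoint_iff subsetI)
    then show ?thesis
    proof cases
      case 1
      then have aT: "a \<notin> T" using aW by blast
      have "{e \<in> E'. en' e \<subseteq> T} = {e \<in> E. en e \<subseteq> T}"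
      proof (intro set_eqI iffI; clarify)
        fix e assume e: "e \<in> E'" "en' e \<subseteq> T"
        then have "en e \<inter> W = {}" using mem_en'_inside[OF aW] aT by blast
        then show "e \<in> E \<and> en e \<subseteq> T" using e en'_same[of e] E'E by auto
      next
        fix e assume e: "e \<in> E" "en e \<subseteq> T"
        then have "en e \<inter> W = {}" using 1 by blast
        moreover have "en e \<noteq> {}" using card_en[OF e(1)] by auto
        ultimately show "e \<in> E' \<and> en' e \<subseteq> T" using e en'_same[of e] by (auto simp: E'_def)
      qed
      moreover have "\<exists>e\<in>E'. en' e = {u, w}" if uw: "u \<in> T" "w \<in> T" "u \<noteq> w" for u w
      proof -
        obtain e where e: "e \<in> E" "en e = {u, w}" using pairs[OF uw] by blast
        have "en e \<inter> W = {}" unfolding e(2) using 1 uw(1,2) by blast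
        then show ?thesis using e en'_same[of e] by (auto simp: E'_def)
      qed
      ultimately have "C.clean_triangle T" using T by (simp add: C.clean_triangle_def clean_triangle_def)
      then obtain e where e: "e \<in> M'" "en' e \<subseteq> T" using tri' by blast
      then have "en e \<inter> W = {}" using mem_en'_inside[OF aW] aT by blast
      then show ?thesis using e en'_same[of e] by auto
    next
      case 2
      then show ?thesis using gW by blast
    next
      case 3
      have ud: "u \<noteq> d" using 3 by blast
      obtain t where t: "T = {u, d, t}" "t \<noteq> u" "t \<noteq> d"
        using cT 3 ud by (auto simp: card_3_iff doubleton_eq_iff insert_commute)
      obtain f where f: "f \<in> E" "en f = {u, d}" using pairs[of u d] 3 ud by blast
      have fE': "f \<in> E'" using f 3 by (auto simp: E'_def)
      show ?thesis
      proof (cases "u = x")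
        case True
        then show ?thesis using x_outer[of f d] f 3 by blast
      next
        case ux: False
        \<comment> \<open>Only one edge leaves \<open>W\<close> at \<open>u\<close>, so
          \<open>T\<close> has two vertices in common with \<open>W\<close>. Either \<open>x\<close>
          is one of them and its edge to \<open>d\<close> belongs to \<open>M'\<close>, or they are
          \<open>y\<close> and \<open>z\<close>, joined by \<open>g\<close>.\<close>
        have tW: "t \<in> W"
        proof (rule ccontr)
          assume "t \<notin> W"
          obtain h where h: "h \<in> E" "en h = {u, t}" using pairs[of u t] t 3 by auto
          then have "h \<in> E'" using \<open>t \<notin> W\<close> by (auto simp: E'_def)
          then have "h = f" using outer_E'_unique[OF 3(2), of h f] fE' f h by blast
          then show False using f h t by (auto simp: doubleton_eq_iff)
        qed
        show ?thesis
        proof (cases "t = x")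
          case True
          obtain h where "h \<in> E" "en h = {t, d}" using pairs[of t d] t by auto
          then show ?thesis using x_outer[of h d] 3 True t by blast
        next
          case False
          then have "{u, t} = {y, z}" using ux tW 3 yz t by auto
          then have "en g \<subseteq> T" unfolding g(2) t(1) by blast
          then show ?thesis by blast
        qed
      qed
    qed
  qed
  ultimately show ?thesis by blast
qed

end

text \<open>Clean triangles can share an edge, so they are contracted one at a time.\<close>

lemma matching_hitting_clean_triangles:
  assumes "bridgeless_subcubic E en"
  shows "\<exists>M. subcubic.matching E en M \<and> subcubic.cubic_vertices E en \<subseteq> (\<Union>e\<in>M. en e) \<and>
    (\<forall>T. subcubic.clean_triangle E en T \<longrightarrow> (\<exists>e\<in>M. en e \<subseteq> T))"
  using assms
proof (induction "card E" arbitrary: E en rule: less_induct)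
  case less
  interpret G: bridgeless_subcubic E en by (rule less.prems)
  show ?case
  proof (cases "\<exists>W. G.clean_triangle W")
    case False
    then show ?thesis using G.matching_covering_cubic_vertices by auto
  next
    case True
    then obtain W where W: "G.clean_triangle W" by blast
    then have "W \<noteq> {}" by (auto simp: G.clean_triangle_def)
    then obtain a where a: "a \<in> W" by blast
    interpret T: triangle_contraction E en W a by unfold_locales (use W a in auto)
    have "{e \<in> E. en e \<subseteq> W} \<noteq> {}" using W by (auto simp: G.clean_triangle_def simp del: Collect_empty_eq)
    then have "T.E' \<subset> E" by (auto simp: T.E'_def)
    then have "card T.E' < card E" using G.finite_E by (rule psubset_card_mono[rotated])
    from less.hyps[OF this T.bridgeless_contraction] show ?thesis using T.lift_matching by blast
  qed
qed

section \<open>Odd cycles in graphs of maximum degree 2\<close>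

text \<open>Only the vertices are required to be distinct; from \<open>n = 3\<close> on, this makes
  the edges distinct as well.\<close>

definition graph_cycle :: "'e set \<Rightarrow> ('e \<Rightarrow> 'v set) \<Rightarrow> nat \<Rightarrow> (nat \<Rightarrow> 'v) \<Rightarrow> (nat \<Rightarrow> 'e) \<Rightarrow> bool" where
  "graph_cycle F en n v e \<longleftrightarrow> inj_on v {..<n} \<and> (\<forall>i<n. e i \<in> F \<and> en (e i) = {v i, v (Suc i mod n)})"

definition graph_path :: "'e set \<Rightarrow> ('e \<Rightarrow> 'v set) \<Rightarrow> nat \<Rightarrow> (nat \<Rightarrow> 'v) \<Rightarrow> (nat \<Rightarrow> 'e) \<Rightarrow> bool" where
  "graph_path F en k v e \<longleftrightarrow> inj_on v {..k} \<and> (\<forall>i<k. e i \<in> F \<and> en (e i) = {v i, v (Suc i)})"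

definition cycle_vertices :: "nat \<times> (nat \<Rightarrow> 'v) \<times> (nat \<Rightarrow> 'e) \<Rightarrow> 'v set" where
  "cycle_vertices = (\<lambda>(n, v, e). v ` {..<n})"

lemma card_2_other:
  assumes "card A = 2" "x \<in> A" obtains y where "A = {x, y}" "y \<noteq> x"
  using assms by (metis card_2_iff insert_commute insertE singletonD)

lemma three_edges_at_vertex:
  assumes "finite F" "card {e \<in> F. x \<in> en e} \<le> 2"
    and "f \<in> F" "g \<in> F" "h \<in> F" "x \<in> en f" "x \<in> en g" "x \<in> en h" "f \<noteq> g"
  shows "h = f \<or> h = g"
proof (rule ccontr)
  assume "\<not> (h = f \<or> h = g)"
  then have "card {f, g, h} = 3" using assms(9) by auto
  moreover have "card {f, g, h} \<le> card {e \<in> F. x \<in> en e}"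
    using assms by (intro card_mono) auto
  ultimately show False using assms(2) by simp
qed

text \<open>As the path cannot be extended, the other end of \<open>f\<close> lies on it. An inner
  vertex already has its two edges in the path, so only \<open>v 0\<close> is left.\<close>

lemma longest_path_end:
  assumes fin: "finite F" and c2: "\<And>e. e \<in> F \<Longrightarrow> card (en e) = 2"
    and deg: "\<And>x. card {e \<in> F. x \<in> en e} \<le> 2"
    and path: "graph_path F en k v e" "1 \<le> k"
    and longest: "\<nexists>v e. graph_path F en (Suc k) v e"
    and f: "f \<in> F" "v k \<in> en f" "f \<noteq> e (k - 1)"
  shows "en f = {v k, v 0}"
proof -
  have inj: "inj_on v {..k}" and e: "\<And>i. i < k \<Longrightarrow> e i \<in> F \<and> en (e i) = {v i, v (Suc i)}"
    using path by (auto simp: graph_path_def)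
  have inj': "v i = v j \<longleftrightarrow> i = j" if "i \<le> k" "j \<le> k" for i j
    using inj that by (auto simp: inj_on_def)
  obtain w where w: "en f = {v k, w}" "w \<noteq> v k"
    using card_2_other[OF c2[OF f(1)] f(2)] .
  have "w \<in> v ` {..k}"
  proof (rule ccontr)
    assume nw: "w \<notin> v ` {..k}"
    have "inj_on (v(Suc k := w)) {..Suc k}"
      using inj nw by (auto simp: inj_on_def le_Suc_eq)
    moreover have "(e(k := f)) i \<in> F \<and> en ((e(k := f)) i) = {(v(Suc k := w)) i, (v(Suc k := w)) (Suc i)}"
      if "i < Suc k" for i
      using that e[of i] f w by (cases "i = k") auto
    ultimately have "graph_path F en (Suc k) (v(Suc k := w)) (e(k := f))"
      unfolding graph_path_def by blast
    then show False using longest by blast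
  qed
  then obtain i where i: "i \<le> k" "w = v i" by auto
  have "i = 0"
  proof (rule ccontr)
    assume i0: "i \<noteq> 0"
    have ik: "i < k" using i w by (cases "i = k") auto
    obtain j where j: "i = Suc j" using i0 by (cases i) auto
    have ej: "e j \<in> F" "en (e j) = {v j, v i}" using e[of j] j ik by auto
    have ei: "e i \<in> F" "en (e i) = {v i, v (Suc i)}" using e[of i] ik by auto
    have "e j \<noteq> e i"
    proof
      assume "e j = e i"
      then have "v j = v (Suc i) \<or> v j = v i" using ej ei by auto
      then show False using inj'[of j "Suc i"] inj'[of j i] j ik by auto
    qed
    then have "f = e j \<or> f = e i"
      using three_edges_at_vertex[OF fin deg, of "e j" "e i" f "v i"] ej ei f w i by auto
    moreover have "f \<noteq> e j"
      using ej w i inj'[of k j] inj'[of k i] j ik by auto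
    moreover have "f \<noteq> e i"
    proof
      assume "f = e i"
      then have "v k = v i \<or> v k = v (Suc i)" using ei f(2) by auto
      then have "k = Suc i" using inj'[of k i] inj'[of k "Suc i"] ik by auto
      then show False using f(3) \<open>f = e i\<close> by simp
    qed
    ultimately show False by blast
  qed
  then show ?thesis using w i by simp
qed

lemma graph_path_reverse:
  assumes "graph_path F en k v e"
  shows "graph_path F en k (\<lambda>i. v (k - i)) (\<lambda>i. e (k - 1 - i))"
  unfolding graph_path_def
proof (intro conjI allI impI)
  show "inj_on (\<lambda>i. v (k - i)) {..k}"
  proof (rule inj_onI)
    fix i j assume ij: "i \<in> {..k}" "j \<in> {..k}" "v (k - i) = v (k - j)"
    then have "k - i = k - j" using assms by (auto simp: graph_path_def dest: inj_onD)
    then show "i = j" using ij by auto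
  qed
next
  fix i assume i: "i < k"
  define j where "j = k - 1 - i"
  have j: "j < k" "Suc j = k - i" "j = k - Suc i" using i by (auto simp: j_def)
  have "e j \<in> F \<and> en (e j) = {v j, v (Suc j)}" using assms j(1) unfolding graph_path_def by blast
  then show "e (k - 1 - i) \<in> F" "en (e (k - 1 - i)) = {v (k - i), v (k - Suc i)}"
    unfolding j_def[symmetric] j(2) j(3)[symmetric] by (simp_all add: insert_commute)
qed

lemma longest_path_exists:
  assumes "finite F" "\<And>e. e \<in> F \<Longrightarrow> card (en e) = 2" "F \<noteq> {}"
  obtains k v e where "graph_path F en k v e" "1 \<le> k" "\<nexists>v e. graph_path F en (Suc k) v e"
proof -
  define P where "P k \<longleftrightarrow> 1 \<le> k \<and> (\<exists>v e. graph_path F en k v e)" for k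
  obtain f where f: "f \<in> F" using assms by blast
  obtain x y where xy: "en f = {x, y}" "x \<noteq> y" using assms(2)[OF f] by (auto simp: card_2_iff)
  have "graph_path F en 1 (\<lambda>i. if i = 0 then x else y) (\<lambda>_. f)"
    using f xy by (auto simp: graph_path_def inj_on_def)
  then have "P 1" unfolding P_def by blast
  moreover have "k \<le> card (\<Union>e\<in>F. en e)" if k: "P k" for k
  proof -
    obtain v e where p: "graph_path F en k v e" "1 \<le> k" using k P_def by blast
    have "v ` {..<k} \<subseteq> (\<Union>e\<in>F. en e)" using p by (force simp: graph_path_def)
    moreover have "finite (\<Union>e\<in>F. en e)"
      using assms(1,2) by (metis card.infinite finite_UN zero_neq_numeral)
    ultimately have "card (v ` {..<k}) \<le> card (\<Union>e\<in>F. en e)" by (rule card_mono[rotated])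
    moreover have "inj_on v {..<k}" using p by (auto simp: graph_path_def intro: inj_on_subset)
    ultimately show ?thesis by (simp add: card_image)
  qed
  ultimately obtain k where "P k" "\<And>l. P l \<Longrightarrow> l \<le> k"
    using Nat.ex_has_greatest_nat[of P 1 "card (\<Union>e\<in>F. en e)"] by blast
  then show ?thesis using that unfolding P_def by (metis Suc_n_not_le_n le_SucI)
qed

text \<open>Two values suffice at every vertex that is not on an odd cycle. They will become the
  colours 5 and 8, and the edges of the cycles in \<C> will be coloured separately.\<close>

definition odd_cycle_coloring ::
  "'e set \<Rightarrow> ('e \<Rightarrow> 'v set) \<Rightarrow> (nat \<times> (nat \<Rightarrow> 'v) \<times> (nat \<Rightarrow> 'e)) set \<Rightarrow> ('e \<Rightarrow> bool) \<Rightarrow> bool" where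
  "odd_cycle_coloring F en \<C> col \<longleftrightarrow> finite \<C> \<and>
    (\<forall>(n, v, e)\<in>\<C>. odd n \<and> 3 \<le> n \<and> graph_cycle F en n v e) \<and>
    (\<forall>c\<in>\<C>. \<forall>d\<in>\<C>. c \<noteq> d \<longrightarrow> cycle_vertices c \<inter> cycle_vertices d = {}) \<and>
    (\<forall>f\<in>F. \<forall>g\<in>F. \<forall>x. f \<noteq> g \<and> x \<in> en f \<and> x \<in> en g \<and> x \<notin> (\<Union>c\<in>\<C>. cycle_vertices c) \<longrightarrow> col f \<noteq> col g)"

text \<open>As degrees are at most 2, the edges meeting a longest path are its own edges and at most
  one closing edge. They form a whole component, which is removed; on it, the parity of the index
  serves as colour.\<close>

lemma odd_cycle_coloring_exists:
  assumes "finite F" "\<And>e. e \<in> F \<Longrightarrow> card (en e) = 2" "\<And>x. card {e \<in> F. x \<in> en e} \<le> 2"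
  shows "\<exists>\<C> col. odd_cycle_coloring F en \<C> col"
  using assms
proof (induction "card F" arbitrary: F rule: less_induct)
  case less
  note fin = less.prems(1) and c2 = less.prems(2) and deg = less.prems(3)
  show ?case
  proof (cases "F = {}")
    case True
    then have "odd_cycle_coloring F en {} (\<lambda>_. True)" by (simp add: odd_cycle_coloring_def)
    then show ?thesis by blast
  next
    case False
    obtain k v e where path: "graph_path F en k v e" and k: "1 \<le> k"
      and longest: "\<nexists>v e. graph_path F en (Suc k) v e"
      by (rule longest_path_exists[OF fin c2 False])
    have inj: "inj_on v {..k}" and e: "\<And>i. i < k \<Longrightarrow> e i \<in> F \<and> en (e i) = {v i, v (Suc i)}"
      using path by (auto simp: graph_path_def)
    have inj': "v i = v j \<longleftrightarrow> i = j" if "i \<le> k" "j \<le> k" for i j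
      using inj that by (auto simp: inj_on_def)
    have einj: "i = j" if "i < k" "j < k" "e i = e j" for i j
    proof -
      have "{v i, v (Suc i)} = {v j, v (Suc j)}" using e that by metis
      then show ?thesis using that inj' by (auto simp: doubleton_eq_iff)
    qed
    define X where "X = v ` {..k}"
    define Q where "Q = {f \<in> F. en f \<inter> X \<noteq> {}}"
    have Qcases: "f \<in> e ` {..<k} \<or> en f = {v 0, v k}" if f: "f \<in> Q" for f
    proof -
      obtain i where i: "i \<le> k" "v i \<in> en f" and fF: "f \<in> F" using f by (auto simp: Q_def X_def)
      consider "i = k" | "i = 0" | "0 < i" "i < k" using i by linarith
      then show ?thesis
      proof cases
        case 1
        show ?thesis
        proof (cases "f = e (k - 1)")
          case False
          then have "en f = {v k, v 0}"
            using longest_path_end[of F en k v e f] fin c2 deg path k longest fF i 1 by blast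
          then show ?thesis by blast
        qed (use k in auto)
      next
        case 2
        show ?thesis
        proof (cases "f = e 0")
          case False
          then have "en f = {v (k - k), v (k - 0)}"
            using longest_path_end[of F en k "\<lambda>i. v (k - i)" "\<lambda>i. e (k - 1 - i)" f]
              fin c2 deg graph_path_reverse[OF path] k longest fF i 2 by auto
          then show ?thesis by simp
        qed (use k in auto)
      next
        case 3
        then obtain j where j: "i = Suc j" by (cases i) auto
        have "e j \<noteq> e i" using einj[of j i] 3 j by auto
        then have "f = e j \<or> f = e i"
          using three_edges_at_vertex[OF fin deg, of "e j" "e i" f "v i"] e[of i] e[of j] 3 j fF i by auto
        then show ?thesis using 3 j by auto
      qed
    qed
    \<comment> \<open>The component has \<open>k\<close> edges if it is a path and
      \<open>Suc k\<close> if it is a cycle; indices modulo \<open>Suc k\<close> describe both. For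
      \<open>k = 1\<close> the closing edge is parallel to the first one, and the cycle has the even
      length 2.\<close>
    have "\<exists>m d. (m = k \<or> m = Suc k) \<and> inj_on d {..<m} \<and> Q = d ` {..<m} \<and>
      (\<forall>i<m. d i \<in> F \<and> en (d i) = {v i, v (Suc i mod Suc k)})"
    proof (cases "Q \<subseteq> e ` {..<k}")
      case True
      have "e i \<in> Q" if "i < k" for i using e[OF that] that by (auto simp: Q_def X_def)
      then have "Q = e ` {..<k}" using True by blast
      moreover have "inj_on e {..<k}" using einj by (auto intro: inj_onI)
      ultimately show ?thesis using e by (intro exI[of _ k] exI[of _ e]) auto
    next
      case False
      then obtain f where f: "f \<in> Q" "f \<notin> e ` {..<k}" by blast
      have ef: "en f = {v 0, v k}" using Qcases[OF f(1)] f(2) by blast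
      have fF: "f \<in> F" using f by (simp add: Q_def)
      have "g = f" if g: "g \<in> Q" "g \<notin> e ` {..<k}" for g
      proof -
        have "en g = {v 0, v k}" "g \<in> F" using Qcases[OF g(1)] g by (auto simp: Q_def)
        moreover have "e 0 \<in> F" "v 0 \<in> en (e 0)" "f \<noteq> e 0" "g \<noteq> e 0" using e[of 0] k f g by auto
        ultimately show ?thesis
          using three_edges_at_vertex[OF fin deg, of "e 0" f g "v 0"] ef fF by auto
      qed
      moreover have "e i \<in> Q" if "i < k" for i using e[OF that] that by (auto simp: Q_def X_def)
      ultimately have "Q = insert f (e ` {..<k})" using f by blast
      moreover have "(e(k := f)) ` {..<Suc k} = insert f (e ` {..<k})" by (auto simp: lessThan_Suc)
      moreover have "inj_on (e(k := f)) {..<Suc k}" using einj f by (auto simp: inj_on_def less_Suc_eq)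
      moreover have "(e(k := f)) i \<in> F \<and> en ((e(k := f)) i) = {v i, v (Suc i mod Suc k)}" if "i < Suc k" for i
        using that e[of i] ef fF by (cases "i = k") (auto simp: insert_commute)
      ultimately show ?thesis by (intro exI[of _ "Suc k"] exI[of _ "e(k := f)"]) simp
    qed
    then obtain m d where m: "m = k \<or> m = Suc k" and dinj: "inj_on d {..<m}" and Qd: "Q = d ` {..<m}"
      and d: "\<And>i. i < m \<Longrightarrow> d i \<in> F \<and> en (d i) = {v i, v (Suc i mod Suc k)}" by blast
    have Qne: "e 0 \<in> Q" using e[of 0] k by (auto simp: Q_def X_def)
    have QF: "Q \<subseteq> F" by (auto simp: Q_def)
    have "card (F - Q) < card F" using Qne QF fin by (intro psubset_card_mono) auto
    moreover have "card {e \<in> F - Q. x \<in> en e} \<le> 2" for x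
      using deg[of x] card_mono[of "{e \<in> F. x \<in> en e}" "{e \<in> F - Q. x \<in> en e}"] fin by fastforce
    ultimately have "\<exists>\<C> col. odd_cycle_coloring (F - Q) en \<C> col"
      using fin c2 by (intro less.hyps) auto
    then obtain \<C> col where Ccol: "odd_cycle_coloring (F - Q) en \<C> col" by blast
    then have finC: "finite \<C>"
      and C: "\<forall>(n, v, e)\<in>\<C>. odd n \<and> 3 \<le> n \<and> graph_cycle (F - Q) en n v e"
      and Cdisj: "\<forall>c\<in>\<C>. \<forall>d\<in>\<C>. c \<noteq> d \<longrightarrow> cycle_vertices c \<inter> cycle_vertices d = {}"
      and col: "\<forall>f\<in>F - Q. \<forall>g\<in>F - Q. \<forall>x. f \<noteq> g \<and> x \<in> en f \<and> x \<in> en g \<and>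
        x \<notin> (\<Union>c\<in>\<C>. cycle_vertices c) \<longrightarrow> col f \<noteq> col g"
      unfolding odd_cycle_coloring_def by - (elim conjE, assumption)+
    have CF: "\<forall>(n, v, e)\<in>\<C>. odd n \<and> 3 \<le> n \<and> graph_cycle F en n v e"
      using C by (fastforce simp: graph_cycle_def)
    have CX: "cycle_vertices c \<inter> X = {}" if c: "c \<in> \<C>" for c
    proof -
      obtain n w g where [simp]: "c = (n, w, g)" by (cases c)
      have "w i \<notin> X" if "i < n" for i
      proof -
        have "g i \<in> F - Q" "w i \<in> en (g i)" using C c that by (auto simp: graph_cycle_def)
        then show ?thesis by (auto simp: Q_def)
      qed
      then show ?thesis by (auto simp: cycle_vertices_def)
    qed
    define col' where "col' f = (if f \<in> Q then even (inv_into {..<m} d f) else col f)" for f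
    define \<C>' where "\<C>' = (if m = Suc k \<and> even k then insert (Suc k, v, d) \<C> else \<C>)"
    have sub: "\<C> \<subseteq> \<C>'" by (auto simp: \<C>'_def)
    have new: "cycle_vertices (Suc k, v, d) = X"
      by (auto simp: cycle_vertices_def X_def lessThan_Suc_atMost)
    have fC: "finite \<C>'" using finC by (simp add: \<C>'_def)
    have cC: "\<forall>(n, v, e)\<in>\<C>'. odd n \<and> 3 \<le> n \<and> graph_cycle F en n v e"
    proof (cases "m = Suc k \<and> even k")
      case True
      then have "odd (Suc k)" "3 \<le> Suc k" using k by (auto elim!: evenE)
      moreover have "graph_cycle F en (Suc k) v d"
        using inj d True unfolding graph_cycle_def lessThan_Suc_atMost by auto
      ultimately show ?thesis using CF True by (simp add: \<C>'_def)
    qed (use CF in \<open>auto simp: \<C>'_def\<close>)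
    have dC: "\<forall>c\<in>\<C>'. \<forall>d\<in>\<C>'. c \<noteq> d \<longrightarrow> cycle_vertices c \<inter> cycle_vertices d = {}"
    proof (intro ballI impI)
      have CX': "cycle_vertices c \<inter> cycle_vertices (Suc k, v, d) = {}" if "c \<in> \<C>" for c
        using CX[OF that] new by simp
      fix b c assume "b \<in> \<C>'" "c \<in> \<C>'" "b \<noteq> c"
      then consider "b \<in> \<C>" "c \<in> \<C>" | "b \<in> \<C>" "c = (Suc k, v, d)" | "b = (Suc k, v, d)" "c \<in> \<C>"
        unfolding \<C>'_def by (metis insertE)
      then show "cycle_vertices b \<inter> cycle_vertices c = {}"
        using Cdisj CX' \<open>b \<noteq> c\<close> by cases (blast, blast, metis Int_commute)
    qed
    have "col' f \<noteq> col' g" if f: "f \<in> F" and g: "g \<in> F" and fg: "f \<noteq> g"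
      and x: "x \<in> en f" "x \<in> en g" "x \<notin> (\<Union>c\<in>\<C>'. cycle_vertices c)" for f g x
    proof (cases "f \<in> Q")
      case False
      then have "x \<notin> X" using f x by (auto simp: Q_def)
      have "g \<notin> Q"
      proof
        assume "g \<in> Q"
        then obtain i where "i < m" "g = d i" using Qd by auto
        then have "en g \<subseteq> X" using d[of i] m by (auto simp: X_def intro!: imageI)
        then show False using x \<open>x \<notin> X\<close> by blast
      qed
      then have "col f \<noteq> col g" using col f g fg x False sub by blast
      then show ?thesis using False \<open>g \<notin> Q\<close> by (simp add: col'_def)
    next
      case fQ: True
      then obtain i where i: "i < m" "f = d i" using Qd by auto
      then have "en f \<subseteq> X" using d[of i] m by (auto simp: X_def intro!: imageI)
      then have xX: "x \<in> X" using x by blast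
      then have gQ: "g \<in> Q" using g x by (auto simp: Q_def)
      then obtain j where j: "j < m" "g = d j" using Qd by auto
      have ij: "i \<noteq> j" using fg i j by blast
      \<comment> \<open>Consecutive indices differ in parity except where a cycle of odd length
        closes, and such a cycle belongs to \<open>\<C>'\<close>, so its vertices are
        exempt.\<close>
      have step: "even a \<noteq> even b" if a: "a < m" and b: "b < m" and ab: "b = Suc a mod Suc k" for a b
      proof (cases "a < k")
        case True
        then show ?thesis using ab by simp
      next
        case False
        then have "a = k" "m = Suc k" using a m by auto
        then have "b = 0" using ab by simp
        have "odd k"
        proof
          assume "even k"
          then have "(Suc k, v, d) \<in> \<C>'" using \<open>m = Suc k\<close> by (simp add: \<C>'_def)
          then show False using x(3) xX new by blast
        qed
        then show ?thesis using \<open>a = k\<close> \<open>b = 0\<close> by simp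
      qed
      have le: "a \<le> k" "Suc a mod Suc k \<le> k" if "a < m" for a
        using that m by (auto simp: less_Suc_eq_le[symmetric])
      have modinj: "Suc i mod Suc k \<noteq> Suc j mod Suc k"
        using ij i(1) j(1) m by (auto simp: mod_Suc split: if_splits)
      have "x \<in> {v i, v (Suc i mod Suc k)} \<inter> {v j, v (Suc j mod Suc k)}" using x i j d by auto
      then have "i = Suc j mod Suc k \<or> j = Suc i mod Suc k"
        using inj' le[OF i(1)] le[OF j(1)] ij modinj by auto
      then have "even i \<noteq> even j" using step[of i j] step[of j i] i j by auto
      moreover have "inv_into {..<m} d f = i" "inv_into {..<m} d g = j"
        using i j dinj by (auto intro: inv_into_f_f)
      ultimately show ?thesis using fQ gQ by (simp add: col'_def)
    qed
    then have "\<forall>f\<in>F. \<forall>g\<in>F. \<forall>x. f \<noteq> g \<and> x \<in> en f \<and> x \<in> en g \<and>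
        x \<notin> (\<Union>c\<in>\<C>'. cycle_vertices c) \<longrightarrow> col' f \<noteq> col' g"
      by blast
    with fC cC dC have "odd_cycle_coloring F en \<C>' col'"
      unfolding odd_cycle_coloring_def by (intro conjI)
    then show ?thesis by blast
  qed
qed

section \<open>Low and high windows\<close>

definition cyc :: "nat \<Rightarrow> (nat \<Rightarrow> 'v) \<Rightarrow> nat \<Rightarrow> 'v" where
  "cyc n v j = v (j mod n)"

text \<open>\<open>True\<close> stands for high and aims at the value 2, \<open>False\<close> for
  low and aims at 0. The orientation \<open>s\<close> is the label of the first half of the
  window.\<close>

definition window_label :: "bool \<Rightarrow> nat \<Rightarrow> bool" where
  "window_label s a = (if a < 2 then s else \<not> s)"

text \<open>This prevents chords of the cycle itself from getting opposite labels. A chord inside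
  one half of the window is harmless, since its ends agree.\<close>

definition noncrossing :: "('v \<Rightarrow> 'v) \<Rightarrow> nat \<Rightarrow> (nat \<Rightarrow> 'v) \<Rightarrow> nat \<Rightarrow> bool" where
  "noncrossing p n v i \<longleftrightarrow> (\<forall>a<2. \<forall>b\<in>{2, 3}. p (cyc n v (i + a)) \<noteq> cyc n v (i + b))"

text \<open>Here \<open>st\<close> tells for a vertex of the cycle which label its partner on
  another cycle carries, if any.\<close>

definition conflicts :: "('v \<Rightarrow> bool option) \<Rightarrow> nat \<Rightarrow> (nat \<Rightarrow> 'v) \<Rightarrow> nat \<Rightarrow> bool \<Rightarrow> nat set" where
  "conflicts st n v i s = {a. a < 4 \<and> st (cyc n v (i + a)) = Some (\<not> window_label s a)}"

text \<open>With the cycle, these chords form the complete graph on the vertices at offsets 1 to 4,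
  the edge between offsets 1 and 4 being subdivided by the vertex at offset 0.\<close>

definition crossing_chords_5 :: "('v \<Rightarrow> 'v) \<Rightarrow> nat \<Rightarrow> (nat \<Rightarrow> 'v) \<Rightarrow> bool" where
  "crossing_chords_5 p n v \<longleftrightarrow> n = 5 \<and>
     (\<exists>i. p (cyc n v (i + 1)) = cyc n v (i + 3) \<and> p (cyc n v (i + 2)) = cyc n v (i + 4))"

lemma cyc_in: "0 < n \<Longrightarrow> cyc n v j \<in> v ` {..<n}"
  by (simp add: cyc_def)

lemma cyc_surj: assumes "x \<in> v ` {..<n}" obtains j where "x = cyc n v (i + j)"
proof -
  obtain k where k: "k < n" "x = v k" using assms by blast
  have "i + (k + (n - 1) * i) = k + n * i" using k by (cases n) simp_all
  then have "cyc n v (i + (k + (n - 1) * i)) = v ((k + n * i) mod n)" by (simp only: cyc_def)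
  then have "x = cyc n v (i + (k + (n - 1) * i))" using k by simp
  then show ?thesis using that by blast
qed

lemma cyc_neq:
  assumes "inj_on v {..<n}" "a < b" "b < a + n"
  shows "cyc n v (i + a) \<noteq> cyc n v (i + b)"
proof
  assume "cyc n v (i + a) = cyc n v (i + b)"
  moreover have "(i + a) mod n < n" "(i + b) mod n < n" using assms by auto
  ultimately have "(i + a) mod n = (i + b) mod n" using assms(1) by (auto simp: cyc_def dest: inj_onD)
  then have "n dvd (i + b) - (i + a)" using assms by (metis mod_eq_dvd_iff_nat add_le_mono1 add.commute less_imp_le)
  then have "n dvd b - a" by simp
  then show False using assms by (auto dest: dvd_imp_le)
qed

lemma finite_conflicts: "finite (conflicts st n v i s)"
  by (simp add: conflicts_def)

lemma few_conflicts_if_unlabelled: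
  assumes "a < 4" "st (cyc n v (i + a)) = None"
  shows "\<exists>s. card (conflicts st n v i s) \<le> 1"
proof (rule ccontr)
  assume "\<nexists>s. card (conflicts st n v i s) \<le> 1"
  then have "2 \<le> card (conflicts st n v i True)" "2 \<le> card (conflicts st n v i False)"
    by (metis not_less_eq_eq numeral_2_eq_2 One_nat_def)+
  moreover have "conflicts st n v i True \<inter> conflicts st n v i False = {}"
    by (auto simp: conflicts_def window_label_def split: if_splits)
  then have "card (conflicts st n v i True \<union> conflicts st n v i False) =
      card (conflicts st n v i True) + card (conflicts st n v i False)"
    by (intro card_Un_disjoint finite_conflicts)
  moreover have "conflicts st n v i True \<union> conflicts st n v i False \<subseteq> {..<4} - {a}"
    using assms(2) by (auto simp: conflicts_def)
  then have "card (conflicts st n v i True \<union> conflicts st n v i False) \<le> card ({..<4} - {a})"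
    by (intro card_mono) auto
  ultimately show False using assms(1) by simp
qed

text \<open>A window containing an unlabelled vertex has at most three vertices that can conflict, so one of its
  two orientations has at most one conflict. If a vertex without chord precedes one with a chord, the
  three windows containing both in this order cannot all be crossed by a chord, unless \<open>n = 5\<close>.\<close>

lemma cheap_window:
  assumes n: "odd n" "5 \<le> n" and inj: "inj_on v {..<n}" and inv: "\<And>x. p (p x) = x"
    and H2: "\<not> crossing_chords_5 p n v"
    and st: "\<And>x. x \<in> v ` {..<n} \<Longrightarrow> p x \<in> v ` {..<n} \<Longrightarrow> st x = None"
  shows "(\<exists>i s. noncrossing p n v i \<and> card (conflicts st n v i s) \<le> 1) \<or>
    (\<forall>i. noncrossing p n v i) \<and> (\<exists>b. \<forall>j. st (cyc n v j) = Some b)"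
proof -
  define X where "X = v ` {..<n}"
  define V where "V = cyc n v"
  have VX: "V j \<in> X" for j using n cyc_in[of n v j] by (simp add: V_def X_def)
  have Xsurj: "\<exists>j. x = V (i + j)" if "x \<in> X" for x i
    using that unfolding X_def V_def by (rule cyc_surj) blast
  have neq: "V (i + a) \<noteq> V (i + b)" if "a < b" "b < a + n" for i a b
    using cyc_neq[OF inj that] by (simp add: V_def)
  have period: "V (i + n) = V i" for i by (simp add: V_def cyc_def)
  have cardX: "card X = n" using inj by (simp add: X_def card_image)
  define K where "K = {x \<in> X. p x \<in> X \<and> p x \<noteq> x}"
  show ?thesis
  proof (cases "K = {}")
    case False
    \<comment> \<open>The ends of chords come in pairs, but the cycle is odd, so some vertex is not
      the end of a chord. Going round from there, one meets such a vertex directly followed by an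
      end of a chord.\<close>
    have "even (card K)"
    proof (rule even_card_involution[where p = p])
      show "finite K" by (simp add: K_def X_def)
      fix u assume u: "u \<in> K"
      then show "p u \<in> K \<and> p (p u) = u \<and> p u \<noteq> u" using inv[of u] by (auto simp: K_def)
    qed
    then have "K \<noteq> X" using cardX n by auto
    then obtain x0 where x0: "x0 \<in> X" "x0 \<notin> K" by (auto simp: K_def)
    obtain m where "x0 = V (0 + m)" using Xsurj[OF x0(1)] by blast
    then have m: "V m \<notin> K" using x0(2) by simp
    have "\<exists>i. V i \<notin> K \<and> V (Suc i) \<in> K"
    proof (rule ccontr)
      assume *: "\<not> ?thesis"
      have "V (m + j) \<notin> K" for j using m * by (induction j) auto
      moreover obtain z where z: "z \<in> K" using False by blast
      then have "z \<in> X" by (simp add: K_def)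
      then obtain j where "z = V (m + j)" using Xsurj by blast
      ultimately show False using z by blast
    qed
    then obtain i0 where i0: "V i0 \<notin> K" "V (Suc i0) \<in> K" by blast
    \<comment> \<open>\<open>b\<close> is \<open>i0 - 2\<close> modulo \<open>n\<close>, so that the
      windows starting at \<open>b\<close>, \<open>b + 1\<close> and \<open>b + 2\<close> all
      contain the chordless vertex \<open>V (b + 2)\<close> and the end \<open>V (b + 3)\<close> of
      a chord.\<close>
    define b where "b = i0 + (n - 2)"
    have b2: "V (b + 2) = V i0" "V (b + 3) = V (Suc i0)"
    proof -
      have "b + 2 = i0 + n" "b + 3 = Suc i0 + n" using n by (simp_all add: b_def)
      then show "V (b + 2) = V i0" "V (b + 3) = V (Suc i0)" by (simp_all only: period)
    qed
    have x: "V (b + 2) \<notin> K" and y: "V (b + 3) \<in> K" using i0 b2 by simp_all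
    have sty: "st (V (b + 3)) = None" using y st by (auto simp: K_def X_def)
    have xno: "p (V (b + 2)) \<noteq> V j" "p (V j) \<noteq> V (b + 2)" if "V j \<noteq> V (b + 2)" for j
      using x that VX[of j] VX[of "b + 2"] inv[of "V j"] by (auto simp: K_def)
    have "\<exists>i s. noncrossing p n v i \<and> card (conflicts st n v i s) \<le> 1"
    proof (rule ccontr)
      assume none: "\<not> ?thesis"
      \<comment> \<open>\<open>V (b + 3)\<close> is unlabelled because its partner is on the cycle,
        so each of the three windows has an orientation with at most one conflict and can fail only
        by being crossed.\<close>
      have cross: "\<not> noncrossing p n v (b + d)" if "d \<le> 2" for d
      proof -
        have "st (cyc n v (b + d + (3 - d))) = None" using sty that by (simp add: V_def)
        moreover have "3 - d < 4" by simp
        ultimately show ?thesis using few_conflicts_if_unlabelled none by blast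
      qed
      have nc: "\<not> noncrossing p n v (b + d) \<Longrightarrow> p (V (b + d)) = V (b + d + 2) \<or> p (V (b + d)) = V (b + d + 3) \<or>
          p (V (b + d + 1)) = V (b + d + 2) \<or> p (V (b + d + 1)) = V (b + d + 3)" for d
        by (auto simp: noncrossing_def V_def numeral_2_eq_2 less_Suc_eq)
      \<comment> \<open>As \<open>V (b + 2)\<close> has no chord, each window leaves only two
        candidates for the crossing chord.\<close>
      have c0: "p (V (b + 0)) = V (b + 3) \<or> p (V (b + 1)) = V (b + 3)"
        using nc[OF cross[of 0]] xno[of "b + 0"] xno[of "b + 1"] neq[of 0 2 b] neq[of 1 2 b] n by auto
      have c2: "p (V (b + 3)) = V (b + 4) \<or> p (V (b + 3)) = V (b + 5)"
        using nc[OF cross[of 2]] xno[of "b + 4"] xno[of "b + 5"] neq[of 2 4 b] neq[of 2 5 b] n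
        by (auto simp: eval_nat_numeral)
      have c1: "p (V (b + 1)) = V (b + 3) \<or> p (V (b + 1)) = V (b + 4)"
        using nc[OF cross[of 1]] xno[of "b + 3"] xno[of "b + 4"] neq[of 2 3 b] neq[of 2 4 b] n
        by (auto simp: eval_nat_numeral)
      have py: "p (V (b + 3)) = V (b + 0) \<or> p (V (b + 3)) = V (b + 1)"
        using c0 inv by metis
      \<comment> \<open>The partner of \<open>V (b + 3)\<close> is \<open>V b\<close> or
        \<open>V (b + 1)\<close>, and it is also \<open>V (b + 4)\<close> or
        \<open>V (b + 5)\<close>. These four vertices are different in a longer cycle.\<close>
      have n5: "n = 5"
      proof (rule ccontr)
        assume "n \<noteq> 5"
        then have "5 < n" using n by simp
        then show False
          using py c2 neq[of 0 4 b] neq[of 0 5 b] neq[of 1 4 b] neq[of 1 5 b] by auto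
      qed
      have "p (V (b + 3)) = V (b + 5)"
        using py c2 neq[of 1 4 b] neq[of 1 5 b] neq[of 0 4 b] n5 period[of b] by auto
      moreover have "p (V (b + 1)) \<noteq> V (b + 3)"
      proof
        assume "p (V (b + 1)) = V (b + 3)"
        then have "p (V (b + 3)) = V (b + 1)" using inv by metis
        then show False using calculation neq[of 1 5 b] n5 by auto
      qed
      \<comment> \<open>In a 5-cycle, \<open>V (b + 5)\<close> is \<open>V b\<close> and
        \<open>V (b + 6)\<close> is \<open>V (b + 1)\<close>. Counted from \<open>b + 2\<close>, the
        two chords found are the excluded crossing pair.\<close>
      then have "p (V (b + 4)) = V (b + 1)" using c1 inv by metis
      moreover have "b + 1 + n = b + 6" using n5 by simp
      then have "V (b + 6) = V (b + 1)" using period[of "b + 1"] by metis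
      moreover have shift: "b + 2 + 1 = b + 3" "b + 2 + 3 = b + 5" "b + 2 + 2 = b + 4" "b + 2 + 4 = b + 6"
        by simp_all
      ultimately have "p (V (b + 2 + 1)) = V (b + 2 + 3)" "p (V (b + 2 + 2)) = V (b + 2 + 4)"
        unfolding shift by simp_all
      then show False using H2 n5 unfolding crossing_chords_5_def V_def by blast
    qed
    then show ?thesis by blast
  next
    case True
    have nonc: "noncrossing p n v i" for i
      unfolding noncrossing_def
    proof (intro allI impI ballI notI)
      fix a c :: nat assume ac: "a < 2" "c \<in> {2, 3}" "p (cyc n v (i + a)) = cyc n v (i + c)"
      then have "V (i + a) \<noteq> V (i + c)" using neq[of a c i] n by auto
      then have "V (i + a) \<in> K" using ac(3) VX by (auto simp: K_def V_def)
      then show False using True by blast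
    qed
    show ?thesis
    proof (cases "\<exists>j. st (V j) = None")
      case True
      then obtain j where "st (V j) = None" by blast
      then have "st (cyc n v (j + 0)) = None" by (simp add: V_def)
      then have "\<exists>s. card (conflicts st n v j s) \<le> 1" by (intro few_conflicts_if_unlabelled[of 0]) simp_all
      then show ?thesis using nonc by blast
    next
      case False
      define g where "g j = the (st (V j))" for j
      have g: "st (V j) = Some (g j)" for j using False by (simp add: g_def)
      show ?thesis
      proof (cases "\<exists>i s. card (conflicts st n v i s) \<le> 1")
        case True
        then show ?thesis using nonc by blast
      next
        case many: False
        \<comment> \<open>Labels cannot alternate around an odd cycle.\<close>
        have "\<exists>j. g j = g (Suc j)"
        proof (rule ccontr)
          assume "\<nexists>j. g j = g (Suc j)"
          then have "g (Suc j) = (\<not> g j)" for j by blast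
          then have alt: "g j = (g 0 = even j)" for j by (induction j) simp_all
          have "g n \<noteq> g 0" using alt[of n] n by simp
          then show False using period[of 0] by (simp add: g_def)
        qed
        then obtain j where j: "g j = g (Suc j)" by blast
        \<comment> \<open>If two equal labels were followed by a different one, the window starting
          there, suitably oriented, would agree in its first three positions. So the label of two
          equal neighbours propagates around the whole cycle.\<close>
        have step: "g (i + 2) = g i" if i: "g i = g (i + 1)" for i
        proof (rule ccontr)
          assume ne: "g (i + 2) \<noteq> g i"
          have "conflicts st n v i (g i) \<subseteq> {3}"
          proof
            fix a assume "a \<in> conflicts st n v i (g i)"
            then have a: "a < 4" "g (i + a) = (\<not> window_label (g i) a)"
              using g[of "i + a"] by (auto simp: conflicts_def V_def)
            consider "a = 0" | "a = 1" | "a = 2" | "a = 3" using a(1) by linarith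
            then show "a \<in> {3}" by cases (use a(2) i ne in \<open>auto simp: window_label_def\<close>)
          qed
          then have "card (conflicts st n v i (g i)) \<le> 1" using card_mono[of "{3::nat}"] by fastforce
          then show False using many by blast
        qed
        have const: "g (j + i) = g j \<and> g (Suc (j + i)) = g j" for i
          using j step by (induction i) auto
        have "st (cyc n v k) = Some (g j)" for k
        proof -
          have "V k \<in> X" using VX .
          then obtain i where "V k = V (j + i)" using Xsurj by blast
          then show ?thesis using g[of "j + i"] const[of i] by (simp add: V_def)
        qed
        then show ?thesis using nonc by blast
      qed
    qed
  qed
qed

text \<open>The values on \<open>M\<close> at four consecutive vertices that allow an odd cycle to be coloured.\<close>

definition decodable_window :: "(nat \<Rightarrow> nat) \<Rightarrow> bool" where
  "decodable_window w \<longleftrightarrow>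
     (w 0 = 0 \<and> w 1 = 0 \<and> 1 \<le> w 2 \<and> 1 \<le> w 3) \<or> (w 0 \<le> 1 \<and> w 1 \<le> 1 \<and> w 2 = 2 \<and> w 3 = 2) \<or>
     (1 \<le> w 0 \<and> 1 \<le> w 1 \<and> w 2 = 0 \<and> w 3 = 0) \<or> (w 0 = 2 \<and> w 1 = 2 \<and> w 2 \<le> 1 \<and> w 3 \<le> 1)"

section \<open>Choosing windows on all odd cycles simultaneously\<close>

locale cycle_family =
  fixes I :: "'i set" and n :: "'i \<Rightarrow> nat" and v :: "'i \<Rightarrow> nat \<Rightarrow> 'v" and p :: "'v \<Rightarrow> 'v"
  assumes finite_I: "finite I"
    and odd_n: "c \<in> I \<Longrightarrow> odd (n c)" and n_ge: "c \<in> I \<Longrightarrow> 5 \<le> n c"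
    and inj_v: "c \<in> I \<Longrightarrow> inj_on (v c) {..<n c}"
    and disjoint_cycles: "c \<in> I \<Longrightarrow> d \<in> I \<Longrightarrow> c \<noteq> d \<Longrightarrow> v c ` {..<n c} \<inter> v d ` {..<n d} = {}"
    and involution: "p (p x) = x"
    and no_crossing_chords: "c \<in> I \<Longrightarrow> \<not> crossing_chords_5 p (n c) (v c)"
begin

definition X :: "'i \<Rightarrow> 'v set" where "X c = v c ` {..<n c}"
definition V :: "'i \<Rightarrow> nat \<Rightarrow> 'v" where "V c = cyc (n c) (v c)"

definition cycle_label :: "'i \<Rightarrow> nat \<times> bool \<Rightarrow> 'v \<Rightarrow> bool option" where
  "cycle_label c = (\<lambda>(i, s) x. if x \<in> {V c i, V c (i + 1)} then Some s
     else if x \<in> {V c (i + 2), V c (i + 3)} then Some (\<not> s) else None)"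

text \<open>The cycles are disjoint, so the one picked by \<open>SOME\<close> is the only one
  through \<open>x\<close>.\<close>

definition label :: "('i \<Rightarrow> nat \<times> bool) \<Rightarrow> 'v \<Rightarrow> bool option" where
  "label \<sigma> x = (if \<exists>c\<in>I. x \<in> X c then let c = SOME c. c \<in> I \<and> x \<in> X c in cycle_label c (\<sigma> c) x else None)"

definition valid :: "('i \<Rightarrow> nat \<times> bool) \<Rightarrow> bool" where
  "valid \<sigma> \<longleftrightarrow> (\<forall>c\<in>I. noncrossing p (n c) (v c) (fst (\<sigma> c)))"

text \<open>Both ends of an edge with opposite labels are counted, so minimising this set minimises
  the number of such edges.\<close>

definition opposed :: "('i \<Rightarrow> nat \<times> bool) \<Rightarrow> 'v set" where
  "opposed \<sigma> = {x. \<exists>b. label \<sigma> x = Some b \<and> label \<sigma> (p x) = Some (\<not> b)}"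

text \<open>Masking the chords of \<open>c\<close> makes this independent of the window chosen on
  \<open>c\<close>, so it can be kept fixed while that window varies.\<close>

definition outer_label :: "('i \<Rightarrow> nat \<times> bool) \<Rightarrow> 'i \<Rightarrow> 'v \<Rightarrow> bool option" where
  "outer_label \<sigma> c x = (if p x \<in> X c then None else label \<sigma> (p x))"

lemma V_in_X: "c \<in> I \<Longrightarrow> V c j \<in> X c"
  using n_ge[of c] cyc_in[of "n c" "v c" j] by (simp add: V_def X_def)

lemma V_neq: "c \<in> I \<Longrightarrow> a < b \<Longrightarrow> b < a + 5 \<Longrightarrow> V c (i + a) \<noteq> V c (i + b)"
  using cyc_neq[OF inj_v, of c a b i] n_ge[of c] by (simp add: V_def)

lemma label_in: assumes "c \<in> I" "x \<in> X c" shows "label \<sigma> x = cycle_label c (\<sigma> c) x"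
proof -
  have "(SOME c. c \<in> I \<and> x \<in> X c) = c"
    using assms disjoint_cycles by (intro some_equality) (auto simp: X_def)
  then show ?thesis using assms by (auto simp: label_def)
qed

lemma label_outside: "(\<And>c. c \<in> I \<Longrightarrow> x \<notin> X c) \<Longrightarrow> label \<sigma> x = None"
  by (auto simp: label_def)

lemma label_update: assumes "c \<in> I" "x \<notin> X c" shows "label (\<sigma>(c := q)) x = label \<sigma> x"
proof (cases "\<exists>d\<in>I. x \<in> X d")
  case True
  then obtain d where "d \<in> I" "x \<in> X d" by blast
  then show ?thesis using assms label_in by (metis fun_upd_other)
qed (auto simp: label_outside)

lemma label_window:
  assumes "c \<in> I" "a < 4"
  shows "label \<sigma> (V c (fst (\<sigma> c) + a)) = Some (window_label (snd (\<sigma> c)) a)"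
proof -
  have ne: "V c (fst (\<sigma> c) + b) \<noteq> V c (fst (\<sigma> c) + d)" if "d < 2" "2 \<le> b" "b < 4" for b d
    using V_neq[OF assms(1), of d b "fst (\<sigma> c)"] that by simp
  consider "a = 0" | "a = 1" | "a = 2" | "a = 3" using assms(2) by linarith
  then show ?thesis
    using label_in[OF assms(1) V_in_X[OF assms(1)], of \<sigma> "fst (\<sigma> c) + a"]
      ne[of 0 2] ne[of 1 2] ne[of 0 3] ne[of 1 3]
    by cases (simp_all add: cycle_label_def window_label_def case_prod_unfold)
qed

lemma label_window_obtain:
  assumes "c \<in> I" "x \<in> X c" "label \<sigma> x = Some b"
  obtains a where "a < 4" "x = V c (fst (\<sigma> c) + a)" "b = window_label (snd (\<sigma> c)) a"
proof -
  have "\<exists>a\<in>{0, 1, 2, 3}. x = V c (fst (\<sigma> c) + a)"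
    using assms label_in[OF assms(1,2)] by (auto simp: cycle_label_def case_prod_unfold split: if_splits)
  then obtain a where "a \<in> {0, 1, 2, 3}" "x = V c (fst (\<sigma> c) + a)" by blast
  moreover from this(1) have "a < 4" by auto
  ultimately have a: "a < 4" "x = V c (fst (\<sigma> c) + a)" by blast+
  then show ?thesis using that label_window[OF assms(1) a(1), of \<sigma>] assms(3) by auto
qed

text \<open>A chord with opposite labels would join the two halves of the window.\<close>

lemma noncrossing_partner_label:
  assumes "c \<in> I" "valid \<sigma>" "x \<in> X c" "p x \<in> X c" "label \<sigma> x = Some b"
  shows "label \<sigma> (p x) \<noteq> Some (\<not> b)"
proof
  assume l: "label \<sigma> (p x) = Some (\<not> b)"
  obtain a where a: "a < 4" "x = V c (fst (\<sigma> c) + a)" "b = window_label (snd (\<sigma> c)) a"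
    using label_window_obtain[OF assms(1,3,5)] .
  obtain d where d: "d < 4" "p x = V c (fst (\<sigma> c) + d)" "(\<not> b) = window_label (snd (\<sigma> c)) d"
    using label_window_obtain[OF assms(1,4) l] .
  have nc: "p (V c (fst (\<sigma> c) + k)) \<noteq> V c (fst (\<sigma> c) + l)" if "k < 2" "2 \<le> l" "l < 4" for k l
  proof -
    have "l \<in> {2, 3}" using that by auto
    then show ?thesis using assms(1,2) that(1) by (auto simp: valid_def noncrossing_def V_def)
  qed
  have "(a < 2) \<noteq> (d < 2)" using a(3) d(3) by (auto simp: window_label_def split: if_splits)
  moreover have "p (p x) = x" by (rule involution)
  ultimately show False using nc[of a d] nc[of d a] a d by (auto simp: not_less)
qed

text \<open>This ties the global count to the local one: unlabelled vertices and ends of chords of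
  \<open>c\<close> are not opposed, so the opposed vertices of \<open>c\<close> are the conflicting
  positions of its window.\<close>

lemma card_opposed_in_cycle:
  assumes "c \<in> I" "valid \<sigma>"
  shows "card (opposed \<sigma> \<inter> X c) = card (conflicts (outer_label \<sigma> c) (n c) (v c) (fst (\<sigma> c)) (snd (\<sigma> c)))"
proof -
  let ?B = "conflicts (outer_label \<sigma> c) (n c) (v c) (fst (\<sigma> c)) (snd (\<sigma> c))"
  let ?f = "\<lambda>a. V c (fst (\<sigma> c) + a)"
  have "opposed \<sigma> \<inter> X c = ?f ` ?B"
  proof (intro set_eqI iffI)
    fix x assume x: "x \<in> opposed \<sigma> \<inter> X c"
    then obtain b where b: "label \<sigma> x = Some b" "label \<sigma> (p x) = Some (\<not> b)" by (auto simp: opposed_def)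
    obtain a where a: "a < 4" "x = ?f a" "b = window_label (snd (\<sigma> c)) a"
      using label_window_obtain[OF assms(1) _ b(1)] x by blast
    have "p x \<notin> X c" using noncrossing_partner_label[OF assms _ _ b(1)] b x by blast
    then have "a \<in> ?B" using a b by (auto simp: conflicts_def outer_label_def V_def)
    then show "x \<in> ?f ` ?B" using a by blast
  next
    fix x assume "x \<in> ?f ` ?B"
    then obtain a where a: "a < 4" "x = ?f a" "outer_label \<sigma> c x = Some (\<not> window_label (snd (\<sigma> c)) a)"
      by (auto simp: conflicts_def V_def)
    then have "label \<sigma> (p x) = Some (\<not> window_label (snd (\<sigma> c)) a)" by (auto simp: outer_label_def split: if_splits)
    then show "x \<in> opposed \<sigma> \<inter> X c"
      using label_window[OF assms(1) a(1), of \<sigma>] a(2) V_in_X[OF assms(1)] by (auto simp: opposed_def)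
  qed
  moreover have "inj_on ?f ?B"
  proof (rule inj_onI)
    fix a b assume ab: "a \<in> ?B" "b \<in> ?B" "?f a = ?f b"
    then have "a < 4" "b < 4" by (auto simp: conflicts_def)
    then show "a = b" using ab(3) V_neq[OF assms(1), of a b "fst (\<sigma> c)"] V_neq[OF assms(1), of b a "fst (\<sigma> c)"]
      by (cases a b rule: linorder_cases) auto
  qed
  ultimately show ?thesis by (simp add: card_image)
qed

lemma finite_opposed: "finite (opposed \<sigma>)"
proof (rule finite_subset)
  show "opposed \<sigma> \<subseteq> (\<Union>c\<in>I. X c)" using label_outside[of _ \<sigma>] by (fastforce simp: opposed_def)
  show "finite (\<Union>c\<in>I. X c)" using finite_I by (simp add: X_def)
qed

text \<open>The last summand does not depend on the choice of \<open>c\<close>.\<close>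

lemma card_opposed:
  assumes "c \<in> I" "valid \<sigma>"
  shows "card (opposed \<sigma>) = 2 * card (opposed \<sigma> \<inter> X c) + card {x \<in> opposed \<sigma>. x \<notin> X c \<and> p x \<notin> X c}"
proof -
  let ?D = "opposed \<sigma> \<inter> X c" and ?R = "{x \<in> opposed \<sigma>. x \<notin> X c \<and> p x \<notin> X c}"
  have sym: "p x \<in> opposed \<sigma>" if "x \<in> opposed \<sigma>" for x
    using that involution[of x] by (auto simp: opposed_def)
  have out: "p x \<notin> X c" if "x \<in> ?D" for x
    using that noncrossing_partner_label[OF assms, of x] by (auto simp: opposed_def)
  have "opposed \<sigma> = (?D \<union> p ` ?D) \<union> ?R"
  proof (intro set_eqI iffI)
    fix x assume x: "x \<in> opposed \<sigma>"
    show "x \<in> (?D \<union> p ` ?D) \<union> ?R"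
    proof (cases "p x \<in> X c")
      case True
      then have "p x \<in> ?D" using sym[OF x] by blast
      then have "p (p x) \<in> p ` ?D" by blast
      then show ?thesis using involution by auto
    qed (use x in auto)
  qed (use sym in auto)
  moreover have "card ((?D \<union> p ` ?D) \<union> ?R) = card (?D \<union> p ` ?D) + card ?R"
    using finite_opposed[of \<sigma>] involution by (intro card_Un_disjoint) auto
  moreover have "card (?D \<union> p ` ?D) = card ?D + card (p ` ?D)"
    using finite_opposed[of \<sigma>] out by (intro card_Un_disjoint) auto
  moreover have "card (p ` ?D) = card ?D"
    using involution by (intro card_image inj_onI) metis
  ultimately show ?thesis by simp
qed

lemma minimal_valid_choice:
  obtains \<sigma> where "valid \<sigma>" "\<forall>\<tau>. valid \<tau> \<longrightarrow> card (opposed \<sigma>) \<le> card (opposed \<tau>)"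
proof -
  \<comment> \<open>With no labels imposed, \<open>cheap_window\<close> just says that a noncrossing
    window exists.\<close>
  have "\<exists>i. noncrossing p (n c) (v c) i" if "c \<in> I" for c
    using cheap_window[OF odd_n[OF that] n_ge[OF that] inj_v[OF that] involution no_crossing_chords[OF that],
      of "\<lambda>_. None"] by auto
  then obtain f where "\<And>c. c \<in> I \<Longrightarrow> noncrossing p (n c) (v c) (f c)" by metis
  then have "valid (\<lambda>c. (f c, True))" by (simp add: valid_def)
  then show ?thesis
    using that ex_has_least_nat[of valid _ "\<lambda>\<sigma>. card (opposed \<sigma>)"] by blast
qed

text \<open>Changing the window of \<open>c\<close> alone alters the number of opposed vertices by
  twice the change in conflicts on \<open>c\<close>. So a global minimum has on \<open>c\<close> the
  fewest conflicts of all noncrossing windows, and \<open>cheap_window\<close> applies. The offset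
  \<open>k\<close> is where the conflict-free half starts; if all partners carry the same label, it
  is the half with this label.\<close>

lemma minimal_choice_unopposed_pair:
  assumes c: "c \<in> I" and \<sigma>: "valid \<sigma>" and min: "\<And>\<tau>. valid \<tau> \<Longrightarrow> card (opposed \<sigma>) \<le> card (opposed \<tau>)"
  shows "\<exists>k\<in>{0, 2}. \<forall>a\<in>{k, k + 1}. label \<sigma> (p (V c (fst (\<sigma> c) + a))) \<noteq> Some (\<not> window_label (snd (\<sigma> c)) a)"
proof -
  let ?st = "outer_label \<sigma> c" and ?i = "fst (\<sigma> c)" and ?s = "snd (\<sigma> c)"
  let ?B = "conflicts ?st (n c) (v c) ?i ?s"
  have best: "card ?B \<le> card (conflicts ?st (n c) (v c) i s)" if nc: "noncrossing p (n c) (v c) i" for i s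
  proof -
    let ?\<tau> = "\<sigma>(c := (i, s))"
    have val: "valid ?\<tau>" using \<sigma> nc by (auto simp: valid_def)
    have "outer_label ?\<tau> c = ?st" using label_update[OF c] by (auto simp: outer_label_def)
    then have 1: "card (opposed ?\<tau> \<inter> X c) = card (conflicts ?st (n c) (v c) i s)"
      using card_opposed_in_cycle[OF c val] by simp
    have "{x \<in> opposed ?\<tau>. x \<notin> X c \<and> p x \<notin> X c} = {x \<in> opposed \<sigma>. x \<notin> X c \<and> p x \<notin> X c}"
      using label_update[OF c] by (auto simp: opposed_def)
    then have "2 * card (opposed \<sigma> \<inter> X c) \<le> 2 * card (opposed ?\<tau> \<inter> X c)"
      using min[OF val] card_opposed[OF c \<sigma>] card_opposed[OF c val] by simp
    then show ?thesis using 1 card_opposed_in_cycle[OF c \<sigma>] by simp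
  qed
  have "\<exists>k\<in>{0, 2}. \<forall>a\<in>{k, k + 1}. a \<notin> ?B"
  proof -
    have "?st x = None" if "p x \<in> v c ` {..<n c}" for x using that by (simp add: outer_label_def X_def)
    with cheap_window[OF odd_n[OF c] n_ge[OF c] inj_v[OF c] involution no_crossing_chords[OF c], of ?st]
    have "(\<exists>i s. noncrossing p (n c) (v c) i \<and> card (conflicts ?st (n c) (v c) i s) \<le> 1) \<or>
        (\<exists>b. \<forall>j. ?st (cyc (n c) (v c) j) = Some b)"
      by metis
    then consider i s where "noncrossing p (n c) (v c) i" "card (conflicts ?st (n c) (v c) i s) \<le> 1"
      | b where "\<forall>j. ?st (cyc (n c) (v c) j) = Some b"
      by metis
    then show ?thesis
    proof cases
      case 1
      then have le: "card ?B \<le> 1" using best le_trans by blast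
      show ?thesis
      proof (rule ccontr)
        assume "\<not> ?thesis"
        then obtain a d where ad: "a \<in> ?B" "d \<in> ?B" "a \<in> {0, 1}" "d \<in> {2, 3}" by auto
        then have "card {a, d} \<le> card ?B" by (intro card_mono finite_conflicts) auto
        then show False using ad le by auto
      qed
    next
      case 2
      show ?thesis
      proof (cases "?s = b")
        case True
        then have "\<forall>a\<in>{0, 0 + 1}. a \<notin> ?B" using 2 by (auto simp: conflicts_def window_label_def)
        then show ?thesis by blast
      next
        case False
        then have "\<forall>a\<in>{2, 2 + 1}. a \<notin> ?B" using 2 by (auto simp: conflicts_def window_label_def)
        then show ?thesis by blast
      qed
    qed
  qed
  then obtain k where k: "k \<in> {0, 2}" "\<forall>a\<in>{k, k + 1}. a \<notin> ?B" by blast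
  have "label \<sigma> (p (V c (?i + a))) \<noteq> Some (\<not> window_label ?s a)" if a: "a \<in> {k, k + 1}" for a
  proof (cases "p (V c (?i + a)) \<in> X c")
    case True
    have "a < 4" using a k by auto
    then show ?thesis
      using noncrossing_partner_label[OF c \<sigma> V_in_X[OF c] True label_window[OF c]] by blast
  next
    case False
    have "a < 4" using a k by auto
    moreover have "a \<notin> ?B" using k(2) a by blast
    ultimately show ?thesis using False by (simp add: conflicts_def outer_label_def V_def)
  qed
  then show ?thesis using k(1) by blast
qed

text \<open>A low end pulls the value of an edge to 0 and a high end to 2; both or neither give 1.
  So low vertices have values at most 1 and high ones at least 1, and in a half without opposed
  vertices the extreme values are attained, as \<open>decodable_window\<close> demands.\<close>

lemma decodable_values_exist:
  "\<exists>h :: 'v \<Rightarrow> nat. (\<forall>x. h (p x) = h x \<and> h x \<le> 2) \<and> (\<forall>c\<in>I. \<exists>i. decodable_window (\<lambda>a. h (V c (i + a))))"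
proof -
  obtain \<sigma> where \<sigma>: "valid \<sigma>" "\<forall>\<tau>. valid \<tau> \<longrightarrow> card (opposed \<sigma>) \<le> card (opposed \<tau>)"
    using minimal_valid_choice .
  define low where "low x \<longleftrightarrow> label \<sigma> x = Some False \<or> label \<sigma> (p x) = Some False" for x
  define high where "high x \<longleftrightarrow> label \<sigma> x = Some True \<or> label \<sigma> (p x) = Some True" for x
  define h :: "'v \<Rightarrow> nat" where "h x = (if low x \<and> \<not> high x then 0 else if high x \<and> \<not> low x then 2 else 1)" for x
  have "h (p x) = h x \<and> h x \<le> 2" for x using involution[of x] by (auto simp: h_def low_def high_def)
  moreover have "decodable_window (\<lambda>a. h (V c (fst (\<sigma> c) + a)))" if c: "c \<in> I" for c
  proof -
    obtain k where k: "k \<in> {0, 2}"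
      "\<And>a. a \<in> {k, k + 1} \<Longrightarrow> label \<sigma> (p (V c (fst (\<sigma> c) + a))) \<noteq> Some (\<not> window_label (snd (\<sigma> c)) a)"
      using minimal_choice_unopposed_pair[OF c \<sigma>(1)] \<sigma>(2) by blast
    define w where "w a = h (V c (fst (\<sigma> c) + a))" for a
    have weak: "if window_label (snd (\<sigma> c)) a then 1 \<le> w a else w a \<le> 1" if "a < 4" for a
      using label_window[OF c that, of \<sigma>] by (auto simp: w_def h_def low_def high_def)
    have strong: "w a = (if window_label (snd (\<sigma> c)) a then 2 else 0)" if "a \<in> {k, k + 1}" for a
    proof -
      have "a < 4" using that k(1) by auto
      then show ?thesis using label_window[OF c, of a \<sigma>] k(2)[OF that]
        by (auto simp: w_def h_def low_def high_def)
    qed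
    have "decodable_window w"
      using k(1) strong[of k] strong[of "k + 1"] weak[of 0] weak[of 1] weak[of 2] weak[of 3]
      by (cases "snd (\<sigma> c)") (auto simp: decodable_window_def window_label_def eval_nat_numeral)
    then show ?thesis by (simp add: w_def[abs_def])
  qed
  ultimately show ?thesis by blast
qed

end

section \<open>Colouring without bridges\<close>

text \<open>Distance at least 3 in Z/11, for the representatives 0 to 10: the upper bound is 11 -
  3.\<close>

definition apart :: "nat \<Rightarrow> nat \<Rightarrow> bool" where
  "apart a b \<longleftrightarrow> 3 \<le> \<bar>int a - int b\<bar> \<and> \<bar>int a - int b\<bar> \<le> 8"

lemma apart_commute: "apart a b \<longleftrightarrow> apart b a"
  by (simp add: apart_def abs_minus_commute)

lemma apart_5_8: "apart 5 8" "apart 8 5" "k \<le> 2 \<Longrightarrow> apart 5 k" "k \<le> 2 \<Longrightarrow> apart 8 k"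
  by (auto simp: apart_def)

text \<open>Edge \<open>j\<close> joins the positions \<open>j\<close> and \<open>j + 1\<close>.
  After \<open>a\<close>, \<open>b\<close>, \<open>c\<close> on the first three edges, the colours
  \<open>d\<close> and \<open>13 - d\<close>, which are 5 and 8 in some order, alternate. As
  \<open>n\<close> is odd, the last edge has \<open>13 - d\<close>, which has to fit with
  \<open>a\<close>.\<close>

lemma cycle_edge_colors_from_start:
  assumes n: "odd n" "5 \<le> n" and w2: "\<And>j. w j \<le> 2" and d: "d = 5 \<or> d = 8"
    and ab: "apart a b" "apart b c" "apart c d" "apart (13 - d) a" and le: "a \<le> 10" "b \<le> 10" "c \<le> 10"
    and w: "apart a (w 0)" "apart a (w 1)" "apart b (w 1)" "apart b (w 2)" "apart c (w 2)" "apart c (w 3)"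
  shows "\<exists>\<kappa>. \<forall>j<n. \<kappa> j \<le> 10 \<and> apart (\<kappa> j) (\<kappa> (Suc j mod n)) \<and> apart (\<kappa> j) (w j) \<and> apart (\<kappa> j) (w (Suc j mod n))"
proof -
  define \<kappa> where "\<kappa> j = (if j = 0 then a else if j = 1 then b else if j = 2 then c
    else if odd j then d else 13 - d)" for j :: nat
  have w58: "apart d (w j)" "apart (13 - d) (w j)" for j using d w2[of j] apart_5_8 by auto
  have dd: "apart d (13 - d)" "apart (13 - d) d" "d \<le> 10" "13 - d \<le> 10" using d apart_5_8 by auto
  have "\<kappa> j \<le> 10 \<and> apart (\<kappa> j) (\<kappa> (Suc j mod n)) \<and> apart (\<kappa> j) (w j) \<and> apart (\<kappa> j) (w (Suc j mod n))"
    if j: "j < n" for j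
  proof -
    consider "j = 0" | "j = 1" | "j = 2" | "3 \<le> j" "Suc j < n" | "3 \<le> j" "Suc j = n" using j by linarith
    then show ?thesis
    proof cases
      case 1
      then have "Suc j mod n = 1" using n by simp
      then show ?thesis using 1 ab le w by (simp add: \<kappa>_def)
    next
      case 2
      then have "Suc j mod n = 2" using n by simp
      then show ?thesis using 2 ab le w by (simp add: \<kappa>_def)
    next
      case 3
      then have "Suc j mod n = 3" using n by simp
      then show ?thesis using 3 ab le w by (simp add: \<kappa>_def)
    next
      case 4
      then show ?thesis using w58 dd by (simp add: \<kappa>_def)
    next
      case 5
      then have "even j" using n by auto
      then show ?thesis using 5 w58 dd ab by (simp add: \<kappa>_def)
    qed
  qed
  then show ?thesis by blast
qed

lemma cycle_edge_colors:
  assumes n: "odd n" "5 \<le> n" and h2: "\<And>x. h x \<le> 2"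
    and win: "decodable_window (\<lambda>a. h (cyc n v (i + a)))"
  shows "\<exists>\<kappa>. \<forall>j<n. \<kappa> j \<le> 10 \<and> apart (\<kappa> j) (\<kappa> (Suc j mod n)) \<and>
    apart (\<kappa> j) (h (v j)) \<and> apart (\<kappa> j) (h (v (Suc j mod n)))"
proof -
  define w where "w a = h (cyc n v (i + a))" for a
  have w2: "w j \<le> 2" for j using h2 by (simp add: w_def)
  have dw: "decodable_window w" using win by (simp add: w_def[abs_def])
  have "\<exists>\<kappa>. \<forall>j<n. \<kappa> j \<le> 10 \<and> apart (\<kappa> j) (\<kappa> (Suc j mod n)) \<and> apart (\<kappa> j) (w j) \<and> apart (\<kappa> j) (w (Suc j mod n))"
    using dw unfolding decodable_window_def
  proof (elim disjE conjE)
    \<comment> \<open>The edges inside the window climb by 3. Of 3, 6, 9, the colour 3 fits only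
      with 0 and 9 only with 1 and 2; of 4, 7, 10, the colour 4 fits with 0 and 1 and 10 only with
      2; 6 and 7 fit with all three. The last two cases are these walks backwards, with 5 and 8
      exchanged.\<close>
    assume "w 0 = 0" "w 1 = 0" "1 \<le> w 2" "1 \<le> w 3"
    then show ?thesis using w2[of 2] w2[of 3]
      by (intro cycle_edge_colors_from_start[OF n w2, of 5 3 6 9]) (auto simp: apart_def)
  next
    assume "w 0 \<le> 1" "w 1 \<le> 1" "w 2 = 2" "w 3 = 2"
    then show ?thesis
      by (intro cycle_edge_colors_from_start[OF n w2, of 5 4 7 10]) (auto simp: apart_def)
  next
    assume "1 \<le> w 0" "1 \<le> w 1" "w 2 = 0" "w 3 = 0"
    then show ?thesis using w2[of 0] w2[of 1]
      by (intro cycle_edge_colors_from_start[OF n w2, of 8 9 6 3]) (auto simp: apart_def)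
  next
    assume "w 0 = 2" "w 1 = 2" "w 2 \<le> 1" "w 3 \<le> 1"
    then show ?thesis
      by (intro cycle_edge_colors_from_start[OF n w2, of 8 10 7 4]) (auto simp: apart_def)
  qed
  then obtain \<kappa> where \<kappa>: "\<And>j. j < n \<Longrightarrow> \<kappa> j \<le> 10 \<and> apart (\<kappa> j) (\<kappa> (Suc j mod n)) \<and>
      apart (\<kappa> j) (w j) \<and> apart (\<kappa> j) (w (Suc j mod n))" by blast
  \<comment> \<open>\<open>n - i mod n\<close> plays the role of \<open>- i\<close> modulo
    \<open>n\<close>: the vertex \<open>v k\<close> has position \<open>r k\<close> counted from the
    start of the window.\<close>
  define r where "r k = (k + (n - i mod n)) mod n" for k
  have rn: "r k < n" for k using n by (simp add: r_def)
  have rS: "r (Suc k mod n) = Suc (r k) mod n" for k by (simp add: r_def mod_simps)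
  have wr: "w (r k) = h (v k)" if "k < n" for k
  proof -
    have "(i + r k) mod n = (i mod n + (k + (n - i mod n))) mod n" by (simp add: r_def mod_simps)
    also have "i mod n + (k + (n - i mod n)) = k + n"
      using mod_less_divisor[of n i] n by linarith
    finally show ?thesis using that by (simp add: w_def cyc_def)
  qed
  have "(\<kappa> \<circ> r) j \<le> 10 \<and> apart ((\<kappa> \<circ> r) j) ((\<kappa> \<circ> r) (Suc j mod n)) \<and>
    apart ((\<kappa> \<circ> r) j) (h (v j)) \<and> apart ((\<kappa> \<circ> r) j) (h (v (Suc j mod n)))" if j: "j < n" for j
  proof -
    have "Suc j mod n < n" using n by simp
    then show ?thesis using \<kappa>[OF rn[of j]] wr[OF j] wr[of "Suc j mod n"] by (simp add: rS)
  qed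
  then show ?thesis by blast
qed

text \<open>\<open>z\<close> is the subdividing vertex. Distinct vertices keep all edges apart
  except the parallel edges \<open>e1\<close> and \<open>e2\<close>.\<close>

definition has_H1 :: "'e set \<Rightarrow> ('e \<Rightarrow> 'v set) \<Rightarrow> bool" where
  "has_H1 E en \<longleftrightarrow> (\<exists>x y z e1 e2 e3 e4. distinct [x, y, z] \<and> {e1, e2, e3, e4} \<subseteq> E \<and> e1 \<noteq> e2 \<and>
     en e1 = {x, y} \<and> en e2 = {x, y} \<and> en e3 = {y, z} \<and> en e4 = {x, z})"

text \<open>The complete graph on \<open>a\<close>, \<open>b\<close>, \<open>c\<close>,
  \<open>d\<close>, with the edge between \<open>a\<close> and \<open>d\<close> subdivided by
  \<open>w\<close>.\<close>

definition has_H2 :: "'e set \<Rightarrow> ('e \<Rightarrow> 'v set) \<Rightarrow> bool" where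
  "has_H2 E en \<longleftrightarrow> (\<exists>a b c d w e1 e2 e3 e4 e5 e6 e7. distinct [a, b, c, d, w] \<and>
     {e1, e2, e3, e4, e5, e6, e7} \<subseteq> E \<and> en e1 = {a, b} \<and> en e2 = {b, c} \<and> en e3 = {c, d} \<and>
     en e4 = {a, c} \<and> en e5 = {b, d} \<and> en e6 = {a, w} \<and> en e7 = {d, w})"

definition proper_11_3 :: "'e set \<Rightarrow> ('e \<Rightarrow> 'v set) \<Rightarrow> ('e \<Rightarrow> nat) \<Rightarrow> bool" where
  "proper_11_3 E en f \<longleftrightarrow> (\<forall>e\<in>E. f e \<le> 10) \<and>
     (\<forall>e\<in>E. \<forall>g\<in>E. e \<noteq> g \<longrightarrow> en e \<inter> en g \<noteq> {} \<longrightarrow> apart (f e) (f g))"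

context subcubic
begin

definition mate :: "'e set \<Rightarrow> 'v \<Rightarrow> 'v" where
  "mate M x = (if \<exists>m\<in>M. x \<in> en m then SOME y. y \<noteq> x \<and> (\<exists>m\<in>M. en m = {x, y}) else x)"

lemma mate_eq:
  assumes M: "matching M" and m: "m \<in> M" "en m = {x, y}" "x \<noteq> y"
  shows "mate M x = y"
proof -
  have "(SOME y. y \<noteq> x \<and> (\<exists>m\<in>M. en m = {x, y})) = y"
  proof (rule some_equality)
    show "y \<noteq> x \<and> (\<exists>m\<in>M. en m = {x, y})" using m by blast
    fix z assume "z \<noteq> x \<and> (\<exists>m\<in>M. en m = {x, z})"
    then obtain k where k: "k \<in> M" "en k = {x, z}" "z \<noteq> x" by blast
    then have "x \<in> en k \<inter> en m" using m by blast
    then have "k = m" using M k(1) m(1) unfolding matching_def by blast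
    then show "z = y" using k m by auto
  qed
  moreover have "\<exists>m\<in>M. x \<in> en m" using m by blast
  ultimately show ?thesis by (simp add: mate_def)
qed

lemma mate_cases:
  assumes M: "matching M"
  obtains "mate M x = x" | m where "m \<in> M" "en m = {x, mate M x}" "mate M x \<noteq> x"
proof (cases "\<exists>m\<in>M. x \<in> en m")
  case False
  then show ?thesis using that by (simp add: mate_def)
next
  case True
  then obtain m where m: "m \<in> M" "x \<in> en m" by blast
  then have "m \<in> E" using M by (auto simp: matching_def)
  then obtain y where y: "en m = {x, y}" "x \<noteq> y" using other_end m by metis
  then show ?thesis using mate_eq[OF M m(1) y] that(2)[of m] m by auto
qed

lemma mate_involution: assumes M: "matching M" shows "mate M (mate M x) = x"
proof (cases rule: mate_cases[OF M, of x])
  case (2 m)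
  then have "en m = {mate M x, x}" by (simp add: insert_commute)
  then show ?thesis using mate_eq[OF M 2(1)] 2(3) by blast
qed simp

lemma degree_outside_matching:
  assumes M: "matching M" "cubic_vertices \<subseteq> (\<Union>e\<in>M. en e)"
  shows "card {e \<in> E - M. x \<in> en e} \<le> 2"
proof (cases "x \<in> cubic_vertices")
  case True
  then obtain m where m: "m \<in> M" "x \<in> en m" using M(2) by blast
  have "{e \<in> E - M. x \<in> en e} \<subseteq> {e \<in> E. x \<in> en e} - {m}" using m by blast
  then have "card {e \<in> E - M. x \<in> en e} \<le> card ({e \<in> E. x \<in> en e} - {m})"
    using finite_E by (intro card_mono) auto
  also have "\<dots> = 2"
    using True m M(1) by (subst card_Diff_singleton) (auto simp: cubic_vertices_def matching_def)
  finally show ?thesis .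
next
  case False
  have "card {e \<in> E - M. x \<in> en e} \<le> card {e \<in> E. x \<in> en e}"
    using finite_E by (intro card_mono) auto
  then show ?thesis using degree_le[of x] False by (simp add: cubic_vertices_def)
qed

text \<open>If its vertices spanned no further edge, the cycle would be a clean triangle and one of
  its own edges would be in \<open>M\<close>. A fourth edge is parallel to one of the three and
  completes \<open>H1\<close>.\<close>

lemma three_cycle_has_H1:
  assumes M: "matching M" and hit: "\<And>T. clean_triangle T \<Longrightarrow> \<exists>e\<in>M. en e \<subseteq> T"
    and cyc: "graph_cycle (E - M) en 3 v e"
  shows "has_H1 E en"
proof -
  have inj: "inj_on v {..<3}" and e: "\<And>i. i < 3 \<Longrightarrow> e i \<in> E - M \<and> en (e i) = {v i, v (Suc i mod 3)}"
    using cyc by (auto simp: graph_cycle_def)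
  define x y z where xyz: "x = v 0" "y = v 1" "z = v 2"
  have d: "x \<noteq> y" "y \<noteq> z" "x \<noteq> z" 
    using inj_on_eq_iff[OF inj, of 0 1] inj_on_eq_iff[OF inj, of 1 2] inj_on_eq_iff[OF inj, of 0 2]
    by (simp_all add: xyz)
  obtain a b c where abc: "a \<in> E - M" "b \<in> E - M" "c \<in> E - M" "en a = {x, y}" "en b = {y, z}" "en c = {x, z}"
    using e[of 0] e[of 1] e[of 2] by (auto simp: xyz insert_commute numeral_2_eq_2)
  have ne: "a \<noteq> b" "b \<noteq> c" "a \<noteq> c" using abc d by (auto simp: doubleton_eq_iff)
  let ?T = "{x, y, z}"
  let ?I = "{f \<in> E. en f \<subseteq> ?T}"
  have finI: "finite ?I" using finite_E by simp
  have sub: "{a, b, c} \<subseteq> ?I" using abc by auto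
  have c3: "card {a, b, c} = 3" using ne by simp
  have "\<exists>f\<in>?I. f \<notin> {a, b, c}"
  proof (rule ccontr)
    assume "\<not> ?thesis"
    then have I: "?I = {a, b, c}" using sub by blast
    have "clean_triangle ?T"
      unfolding clean_triangle_def I c3
    proof (intro conjI ballI impI)
      fix u w assume "u \<in> ?T" "w \<in> ?T" "u \<noteq> w"
      then have "{u, w} = en a \<or> {u, w} = en b \<or> {u, w} = en c" unfolding abc by auto
      then show "\<exists>e\<in>E. en e = {u, w}" using abc(1-3) by (metis DiffD1)
    qed (use d in simp_all)
    then obtain m where "m \<in> M" "en m \<subseteq> ?T" using hit by blast
    then have "m \<in> ?I" using M by (auto simp: matching_def)
    then have "m \<in> {a, b, c}" unfolding I .
    then show False using abc(1-3) \<open>m \<in> M\<close> by blast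
  qed
  then obtain f where f: "f \<in> E" "en f \<subseteq> ?T" "f \<noteq> a" "f \<noteq> b" "f \<noteq> c" by blast
  obtain s t where st: "en f = {s, t}" "s \<noteq> t" using ends_obtain[OF f(1)] .
  then have "en f = {x, y} \<or> en f = {y, z} \<or> en f = {x, z}" using f(2) by auto
  then show ?thesis
  proof (elim disjE)
    assume "en f = {x, y}"
    then have "distinct [x, y, z] \<and> {a, f, b, c} \<subseteq> E \<and> a \<noteq> f \<and>
       en a = {x, y} \<and> en f = {x, y} \<and> en b = {y, z} \<and> en c = {x, z}" using abc f d by simp
    then show ?thesis unfolding has_H1_def by (intro exI)
  next
    assume "en f = {y, z}"
    then have "distinct [y, z, x] \<and> {b, f, c, a} \<subseteq> E \<and> b \<noteq> f \<and>
       en b = {y, z} \<and> en f = {y, z} \<and> en c = {z, x} \<and> en a = {y, x}"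
      using abc f d by (simp add: insert_commute)
    then show ?thesis unfolding has_H1_def by (intro exI)
  next
    assume "en f = {x, z}"
    then have "distinct [x, z, y] \<and> {c, f, b, a} \<subseteq> E \<and> c \<noteq> f \<and>
       en c = {x, z} \<and> en f = {x, z} \<and> en b = {z, y} \<and> en a = {x, y}"
      using abc f d by (simp add: insert_commute)
    then show ?thesis unfolding has_H1_def by (intro exI)
  qed
qed

lemma crossing_chords_has_H2:
  assumes M: "matching M" and cycle: "graph_cycle (E - M) en n v e"
    and cross: "crossing_chords_5 (mate M) n v"
  shows "has_H2 E en"
proof -
  have n5: "n = 5" using cross by (simp add: crossing_chords_5_def)
  obtain i where i: "mate M (cyc n v (i + 1)) = cyc n v (i + 3)" "mate M (cyc n v (i + 2)) = cyc n v (i + 4)"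
    using cross by (auto simp: crossing_chords_5_def)
  define V where "V = cyc n v"
  have inj: "inj_on v {..<n}" using cycle by (simp add: graph_cycle_def)
  have neq: "V (i + a) \<noteq> V (i + b)" if "a < b" "b < a + 5" for a b
    using cyc_neq[OF inj, of a b i] that n5 by (simp add: V_def)
  have edge: "e (k mod n) \<in> E \<and> en (e (k mod n)) = {V k, V (Suc k)}" for k
    using cycle n5 by (simp add: graph_cycle_def V_def cyc_def mod_Suc_eq)
  have chord: "\<exists>m\<in>E. en m = {V (i + a), V (i + b)}"
    if "mate M (V (i + a)) = V (i + b)" "a < b" "b < a + 5" for a b
  proof (cases rule: mate_cases[OF M, of "V (i + a)"])
    case 1
    then show ?thesis using neq[OF that(2,3)] that(1) by simp
  next
    case (2 m)
    then show ?thesis using that(1) M by (auto simp: matching_def)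
  qed
  obtain m1 m2 where m: "m1 \<in> E" "en m1 = {V (i + 1), V (i + 3)}" "m2 \<in> E" "en m2 = {V (i + 2), V (i + 4)}"
    using chord[of 1 3] chord[of 2 4] i by (auto simp: V_def)
  have period: "V (Suc (i + 4)) = V (i + 0)" using n5 by (simp add: V_def cyc_def)
  have s: "Suc (i + 1) = i + 2" "Suc (i + 2) = i + 3" "Suc (i + 3) = i + 4" "Suc (i + 0) = i + 1" by simp_all
  define a b c d w where abc: "a = V (i + 1)" "b = V (i + 2)" "c = V (i + 3)" "d = V (i + 4)" "w = V (i + 0)"
  have "distinct [a, b, c, d, w]"
    unfolding abc using neq[of 1 2] neq[of 1 3] neq[of 1 4] neq[of 2 3] neq[of 2 4] neq[of 3 4]
      neq[of 0 1] neq[of 0 2] neq[of 0 3] neq[of 0 4] by simp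
  moreover have "en m1 = {a, c}" "en m2 = {b, d}" using m by (simp_all add: abc)
  moreover have "en (e ((i + 1) mod n)) = {a, b}" "en (e ((i + 2) mod n)) = {b, c}"
    "en (e ((i + 3) mod n)) = {c, d}" "en (e ((i + 0) mod n)) = {a, w}" "en (e ((i + 4) mod n)) = {d, w}"
    unfolding abc edge[THEN conjunct2] s period by (simp_all add: insert_commute)
  ultimately have "distinct [a, b, c, d, w] \<and>
     {e ((i + 1) mod n), e ((i + 2) mod n), e ((i + 3) mod n), m1, m2, e ((i + 0) mod n), e ((i + 4) mod n)} \<subseteq> E \<and>
     en (e ((i + 1) mod n)) = {a, b} \<and> en (e ((i + 2) mod n)) = {b, c} \<and> en (e ((i + 3) mod n)) = {c, d} \<and>
     en m1 = {a, c} \<and> en m2 = {b, d} \<and> en (e ((i + 0) mod n)) = {a, w} \<and> en (e ((i + 4) mod n)) = {d, w}"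
    using m(1,3) edge by simp
  then show ?thesis unfolding has_H2_def by (intro exI)
qed

end

context bridgeless_subcubic
begin

text \<open>The odd cycles interact only through the colours on \<open>M\<close>: once
  \<open>h\<close> is fixed, each of them is coloured independently, and so are the remaining
  components of \<open>F\<close>.\<close>

lemma coloring_exists:
  assumes noH1: "\<not> has_H1 E en" and noH2: "\<not> has_H2 E en"
  shows "\<exists>f. proper_11_3 E en f"
proof -
  obtain M where M: "matching M" "cubic_vertices \<subseteq> (\<Union>e\<in>M. en e)"
    and hit: "\<And>T. clean_triangle T \<Longrightarrow> \<exists>e\<in>M. en e \<subseteq> T"
    using matching_hitting_clean_triangles[OF bridgeless_subcubic_axioms] by blast
  define F where "F = E - M"
  have finF: "finite F" using finite_E by (simp add: F_def)
  have degF: "card {e \<in> F. x \<in> en e} \<le> 2" for x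
    using degree_outside_matching[OF M] by (simp add: F_def)
  have "\<exists>\<C> col. odd_cycle_coloring F en \<C> col"
    using finF degF card_en by (intro odd_cycle_coloring_exists) (auto simp: F_def)
  then obtain \<C> col where occ: "odd_cycle_coloring F en \<C> col" by blast
  define len where "len = (fst :: nat \<times> (nat \<Rightarrow> 'b) \<times> (nat \<Rightarrow> 'a) \<Rightarrow> nat)"
  define ver where "ver c = fst (snd c)" for c :: "nat \<times> (nat \<Rightarrow> 'b) \<times> (nat \<Rightarrow> 'a)"
  define edg where "edg c = snd (snd c)" for c :: "nat \<times> (nat \<Rightarrow> 'b) \<times> (nat \<Rightarrow> 'a)"
  have finC: "finite \<C>" using occ by (simp add: odd_cycle_coloring_def)
  have cyc: "odd (len c)" "3 \<le> len c" "graph_cycle F en (len c) (ver c) (edg c)" if "c \<in> \<C>" for c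
    using occ that by (auto simp: odd_cycle_coloring_def len_def ver_def edg_def case_prod_unfold)
  have cv: "cycle_vertices c = ver c ` {..<len c}" for c
    by (simp add: cycle_vertices_def ver_def len_def case_prod_unfold)
  have disj: "ver c ` {..<len c} \<inter> ver d ` {..<len d} = {}" if "c \<in> \<C>" "d \<in> \<C>" "c \<noteq> d" for c d
    using occ that by (simp add: odd_cycle_coloring_def cv)
  have col: "col f \<noteq> col g" if "f \<in> F" "g \<in> F" "f \<noteq> g" "x \<in> en f" "x \<in> en g"
      "\<And>c. c \<in> \<C> \<Longrightarrow> x \<notin> ver c ` {..<len c}" for f g x
    using occ that unfolding odd_cycle_coloring_def cv by blast
  have len5: "5 \<le> len c" if c: "c \<in> \<C>" for c
  proof -
    have "len c \<noteq> 3" using three_cycle_has_H1[OF M(1) hit] cyc(3)[OF c] noH1 by (metis F_def)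
    moreover have "len c \<noteq> 4" using cyc(1)[OF c] by auto
    ultimately show ?thesis using cyc(2)[OF c] by linarith
  qed
  interpret S: cycle_family \<C> len ver "mate M"
  proof
    fix c assume c: "c \<in> \<C>"
    show "inj_on (ver c) {..<len c}" using cyc(3)[OF c] by (simp add: graph_cycle_def)
    show "\<not> crossing_chords_5 (mate M) (len c) (ver c)"
      using crossing_chords_has_H2[OF M(1)] cyc(3)[OF c] noH2 by (metis F_def)
  qed (use finC cyc len5 disj mate_involution[OF M(1)] in auto)
  obtain h :: "'b \<Rightarrow> nat" where h: "\<And>x. h (mate M x) = h x" "\<And>x. h x \<le> 2"
    and win: "\<And>c. c \<in> \<C> \<Longrightarrow> \<exists>i. decodable_window (\<lambda>a. h (cyc (len c) (ver c) (i + a)))"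
    using S.decodable_values_exist unfolding S.V_def by blast
  have "\<forall>c\<in>\<C>. \<exists>\<kappa>. \<forall>j<len c. \<kappa> j \<le> 10 \<and> apart (\<kappa> j) (\<kappa> (Suc j mod len c)) \<and>
      apart (\<kappa> j) (h (ver c j)) \<and> apart (\<kappa> j) (h (ver c (Suc j mod len c)))"
  proof
    fix c assume c: "c \<in> \<C>"
    obtain i where i: "decodable_window (\<lambda>a. h (cyc (len c) (ver c) (i + a)))" using win[OF c] by blast
    show "\<exists>\<kappa>. \<forall>j<len c. \<kappa> j \<le> 10 \<and> apart (\<kappa> j) (\<kappa> (Suc j mod len c)) \<and>
      apart (\<kappa> j) (h (ver c j)) \<and> apart (\<kappa> j) (h (ver c (Suc j mod len c)))"
      by (rule cycle_edge_colors[where h = h, OF cyc(1)[OF c] len5[OF c] h(2) i])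
  qed
  then obtain \<kappa> where \<kappa>: "\<And>c j. c \<in> \<C> \<Longrightarrow> j < len c \<Longrightarrow> \<kappa> c j \<le> 10 \<and> apart (\<kappa> c j) (\<kappa> c (Suc j mod len c)) \<and>
      apart (\<kappa> c j) (h (ver c j)) \<and> apart (\<kappa> c j) (h (ver c (Suc j mod len c)))" by metis
  have edg: "edg c j \<in> F" "en (edg c j) = {ver c j, ver c (Suc j mod len c)}" if "c \<in> \<C>" "j < len c" for c j
    using cyc(3)[OF that(1)] that(2) by (simp_all add: graph_cycle_def)
  have edg_sub: "en (edg c j) \<subseteq> ver c ` {..<len c}" if "c \<in> \<C>" "j < len c" for c j
  proof -
    have "Suc j mod len c < len c" using that(2) by simp
    then show ?thesis using edg(2)[OF that] that(2) by auto
  qed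
  have edg_inj: "c = d \<and> j = k" if c: "c \<in> \<C>" "j < len c" and d: "d \<in> \<C>" "k < len d" and eq: "edg c j = edg d k" for c d j k
  proof -
    have "ver c j \<in> en (edg d k)" using edg(2)[OF c] eq by simp
    then have cd: "c = d" using edg_sub[OF d] disj[OF c(1) d(1)] c(2) by blast
    have inj: "inj_on (ver c) {..<len c}" using cyc(3)[OF c(1)] by (simp add: graph_cycle_def)
    let ?n = "len c"
    have lt: "Suc j mod ?n < ?n" "Suc k mod ?n < ?n" "k < ?n" using c(2) d(2) cd by auto
    have "{ver c j, ver c (Suc j mod ?n)} = {ver c k, ver c (Suc k mod ?n)}"
      using edg(2)[OF c] edg(2)[OF d] eq cd by simp
    \<comment> \<open>The second alternative, the same edge traversed in both directions, would need
      a cycle of length 2.\<close>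
    then have "j = k \<or> (j = Suc k mod ?n \<and> k = Suc j mod ?n)"
      using lt c(2) inj by (auto simp: doubleton_eq_iff inj_on_eq_iff)
    moreover have "\<not> (j = Suc k mod ?n \<and> k = Suc j mod ?n)"
      using len5[OF c(1)] c(2) lt(3) by (auto simp: mod_Suc split: if_splits)
    ultimately show ?thesis using cd by blast
  qed
  define on_cycle where "on_cycle e \<longleftrightarrow> (\<exists>c\<in>\<C>. \<exists>j<len c. e = edg c j)" for e
  \<comment> \<open>Neither choice matters: \<open>h\<close> agrees on both ends of an edge of
    \<open>M\<close>, and by \<open>edg_inj\<close> an edge determines its cycle and its
    index.\<close>
  define f where "f e = (if e \<in> M then h (SOME x. x \<in> en e)
    else if on_cycle e then (let (c, j) = (SOME (c, j). c \<in> \<C> \<and> j < len c \<and> e = edg c j) in \<kappa> c j)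
    else if col e then 5 else 8)" for e
  have fM: "f e = h x" if e: "e \<in> M" "x \<in> en e" for e x
  proof -
    define y where "y = (SOME x. x \<in> en e)"
    have y: "y \<in> en e" unfolding y_def using e(2) by (rule someI)
    have "h x = h y"
    proof (cases "x = y")
      case False
      have "e \<in> E" using M(1) e(1) by (auto simp: matching_def)
      then have "en e = {x, y}" using other_end[of e x] e(2) y False by blast
      then show ?thesis using mate_eq[OF M(1) e(1) _ False] h(1)[of x] by simp
    qed simp
    then show ?thesis using e(1) by (simp add: f_def y_def)
  qed
  have fcyc: "f (edg c j) = \<kappa> c j" if c: "c \<in> \<C>" "j < len c" for c j
  proof -
    have "(SOME (c', j'). c' \<in> \<C> \<and> j' < len c' \<and> edg c j = edg c' j') = (c, j)"
    proof (rule some_equality)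
      show "case (c, j) of (c', j') \<Rightarrow> c' \<in> \<C> \<and> j' < len c' \<and> edg c j = edg c' j'" using c by simp
      fix q assume "case q of (c', j') \<Rightarrow> c' \<in> \<C> \<and> j' < len c' \<and> edg c j = edg c' j'"
      then have "fst q \<in> \<C>" "snd q < len (fst q)" "edg c j = edg (fst q) (snd q)"
        by (simp_all add: case_prod_unfold)
      then have "c = fst q \<and> j = snd q" by (rule edg_inj[OF c])
      then show "q = (c, j)" by (simp add: prod_eq_iff)
    qed
    moreover have "edg c j \<notin> M" using edg(1)[OF c] by (simp add: F_def)
    moreover have "on_cycle (edg c j)" using c by (auto simp: on_cycle_def)
    ultimately show ?thesis by (simp add: f_def)
  qed
  have foff: "f e = (if col e then 5 else 8)" if "e \<in> F" "\<not> on_cycle e" for e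
    using that by (simp add: f_def F_def)
  have apart_MF: "apart (f e) (f g)" if e: "e \<in> F" "x \<in> en e" and g: "g \<in> M" "x \<in> en g" for e g x
  proof (cases "on_cycle e")
    case True
    then obtain c j where cj: "c \<in> \<C>" "j < len c" "e = edg c j" by (auto simp: on_cycle_def)
    then have "x = ver c j \<or> x = ver c (Suc j mod len c)" using e(2) edg(2)[OF cj(1,2)] by simp
    then show ?thesis using \<kappa>[OF cj(1,2)] fM[OF g] fcyc[OF cj(1,2)] cj(3) by auto
  next
    case False
    then show ?thesis using foff[OF e(1)] fM[OF g] h(2)[of x] apart_5_8 by simp
  qed
  have apart_FF: "apart (f e) (f g)" if e: "e \<in> F" "x \<in> en e" and g: "g \<in> F" "x \<in> en g" and eg: "e \<noteq> g" for e g x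
  proof (cases "\<exists>c\<in>\<C>. x \<in> ver c ` {..<len c}")
    case True
    then obtain c j where c: "c \<in> \<C>" and j: "j < len c" "x = ver c j" by blast
    \<comment> \<open>\<open>k\<close> is the predecessor of \<open>j\<close> on the cycle. By the
      degree bound, the cycle edges with these indices are the only edges of \<open>F\<close> at
      \<open>x\<close>.\<close>
    define k where "k = (j + (len c - 1)) mod len c"
    have k: "k < len c" "Suc k mod len c = j" using j(1) by (simp_all add: k_def mod_Suc_eq)
    have "k \<noteq> j" using k j(1) len5[OF c] by (auto simp: mod_Suc split: if_splits)
    then have ne: "edg c k \<noteq> edg c j" using edg_inj[OF c k(1) c j(1)] by blast
    have x: "x \<in> en (edg c k)" "x \<in> en (edg c j)" using edg(2)[OF c k(1)] edg(2)[OF c j(1)] k j by auto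
    have "e \<in> {edg c k, edg c j}" "g \<in> {edg c k, edg c j}"
      using three_edges_at_vertex[OF finF degF edg(1)[OF c k(1)] edg(1)[OF c j(1)] _ x] e g ne by blast+
    moreover have "apart (f (edg c k)) (f (edg c j))"
      using \<kappa>[OF c k(1)] fcyc[OF c k(1)] fcyc[OF c j(1)] k by simp
    ultimately show ?thesis using eg apart_commute by blast
  next
    case False
    have "\<not> on_cycle e'" if "x \<in> en e'" for e'
      using False edg_sub that unfolding on_cycle_def by blast
    then show ?thesis using foff[OF e(1)] foff[OF g(1)] e g col[OF e(1) g(1) eg e(2) g(2)] False apart_5_8
      by auto
  qed
  have "f e \<le> 10" if e: "e \<in> E" for e
  proof -
    consider "e \<in> M" | c j where "c \<in> \<C>" "j < len c" "e = edg c j" | "e \<in> F" "\<not> on_cycle e"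
      using e unfolding F_def on_cycle_def by blast
    then show ?thesis
    proof cases
      case 1
      have "h y \<le> 10" for y using h(2)[of y] by simp
      then show ?thesis using 1 by (simp add: f_def)
    next
      case 2
      then show ?thesis using \<kappa> fcyc by simp
    next
      case 3
      then show ?thesis using foff by simp
    qed
  qed
  moreover have "apart (f e) (f g)" if eg: "e \<in> E" "g \<in> E" "e \<noteq> g" "en e \<inter> en g \<noteq> {}" for e g
  proof -
    obtain x where x: "x \<in> en e" "x \<in> en g" using eg(4) by blast
    have "\<not> (e \<in> M \<and> g \<in> M)" using M(1) eg unfolding matching_def by blast
    then consider "e \<in> F" "g \<in> M" | "e \<in> M" "g \<in> F" | "e \<in> F" "g \<in> F"
      using eg(1,2) unfolding F_def by blast
    then show ?thesis
    proof cases
      case 1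
      then show ?thesis using apart_MF x by blast
    next
      case 2
      then have "apart (f g) (f e)" using apart_MF x by blast
      then show ?thesis by (simp add: apart_commute)
    next
      case 3
      then show ?thesis using apart_FF x eg(3) by blast
    qed
  qed
  ultimately show ?thesis unfolding proper_11_3_def by blast
qed

end

section \<open>Bridges and the excluded subgraphs\<close>

lemma has_H1_mono: "has_H1 D en \<Longrightarrow> D \<subseteq> E \<Longrightarrow> has_H1 E en"
  unfolding has_H1_def by (elim ex_forward conj_forward) (assumption | erule (1) subset_trans)+

lemma has_H2_mono: "has_H2 D en \<Longrightarrow> D \<subseteq> E \<Longrightarrow> has_H2 E en"
  unfolding has_H2_def by (elim ex_forward conj_forward) (assumption | erule (1) subset_trans)+

text \<open>A colour is incompatible with 5 of the 11 colours, two colours together with at most 10,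
  so one is left. Each witness below is at distance 3 from one of the two colours.\<close>

lemma third_color:
  assumes "a \<le> 10" "b \<le> 10" "a = b \<or> apart a b"
  shows "\<exists>i\<le>10. apart a i \<and> apart b i"
proof -
  have *: "\<exists>i\<le>10. apart a i \<and> apart b i" if ab: "a \<le> b" "b \<le> 10" "a = b \<or> apart a b" for a b
  proof -
    consider "a = b" "b \<le> 7" | "a = b" "7 < b" | "a + 6 \<le> b" "b \<le> a + 8"
      | "a + 3 \<le> b" "b \<le> a + 5" "b \<le> 7" | "a + 3 \<le> b" "b \<le> a + 5" "7 < b"
      using ab by (fastforce simp: apart_def)
    then show ?thesis
    proof cases
      case 1
      then show ?thesis by (intro exI[of _ "a + 3"]) (auto simp: apart_def)
    next
      case 2
      then show ?thesis using ab by (intro exI[of _ "a - 3"]) (auto simp: apart_def)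
    next
      case 3
      then show ?thesis using ab by (intro exI[of _ "a + 3"]) (auto simp: apart_def)
    next
      case 4
      then show ?thesis by (intro exI[of _ "b + 3"]) (auto simp: apart_def)
    next
      case 5
      then show ?thesis using ab by (intro exI[of _ "a - 3"]) (auto simp: apart_def)
    qed
  qed
  show ?thesis
  proof (cases "a \<le> b")
    case True
    then show ?thesis using * assms by blast
  next
    case False
    then show ?thesis using *[of b a] assms apart_commute by auto
  qed
qed

definition rotate_color :: "nat \<Rightarrow> nat \<Rightarrow> nat" where
  "rotate_color k c = (if c + k \<le> 10 then c + k else c + k - 11)"

lemma rotate_color_le: "k \<le> 10 \<Longrightarrow> c \<le> 10 \<Longrightarrow> rotate_color k c \<le> 10"
  by (auto simp: rotate_color_def)

lemma apart_rotate_color: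
  assumes "k \<le> 10" "a \<le> 10" "b \<le> 10" "apart a b"
  shows "apart (rotate_color k a) (rotate_color k b)"
  using assms by (auto simp: rotate_color_def apart_def of_nat_diff split: if_splits)

text \<open>Deleting the bridge \<open>b\<close> lets the induction hypothesis colour both sides at
  once. Every other edge lies inside \<open>A\<close> or avoids it, so rotating the colours inside
  \<open>A\<close> creates no conflict.\<close>

lemma subcubic_coloring:
  assumes "subcubic E en" "\<not> has_H1 E en" "\<not> has_H2 E en"
  shows "\<exists>f. proper_11_3 E en f"
  using assms
proof (induction "card E" arbitrary: E rule: less_induct)
  case less
  interpret G: subcubic E en by (rule less.prems(1))
  show ?case
  proof (cases "\<exists>A. card (G.cut A) = 1")
    case False
    then interpret bridgeless_subcubic E en by unfold_locales auto
    show ?thesis using coloring_exists less.prems(2,3) by blast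
  next
    case True
    then obtain A b where A: "G.cut A = {b}" by (auto simp: card_1_singleton_iff)
    then have b: "b \<in> E" "card (en b \<inter> A) = 1" by (auto simp: G.cut_def)
    obtain x where x: "en b \<inter> A = {x}" using b(2) by (auto simp: card_1_singleton_iff)
    then obtain y where y: "en b = {x, y}" "x \<noteq> y" using G.other_end[OF b(1), of x] by blast
    have xA: "x \<in> A" and yA: "y \<notin> A" using x y by auto
    define D where "D = E - {b}"
    have DE: "D \<subseteq> E" by (auto simp: D_def)
    have finD: "finite D" using G.finite_E by (simp add: D_def)
    have "card {e \<in> D. z \<in> en e} \<le> 3" for z
    proof -
      have "card {e \<in> D. z \<in> en e} \<le> card {e \<in> E. z \<in> en e}"
        using G.finite_E DE by (intro card_mono) auto
      then show ?thesis using G.degree_le[of z] by linarith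
    qed
    then have "subcubic D en" using finD G.card_en DE by unfold_locales auto
    moreover have "card D < card E" using G.finite_E b(1) unfolding D_def by (rule card_Diff1_less)
    moreover have "\<not> has_H1 D en" "\<not> has_H2 D en"
      using less.prems(2,3) has_H1_mono[OF _ DE] has_H2_mono[OF _ DE] by blast+
    ultimately obtain f where f: "proper_11_3 D en f" using less.hyps by blast
    have fle: "f d \<le> 10" if "d \<in> D" for d using f that by (simp add: proper_11_3_def)
    have fap: "apart (f d) (f d')" if "d \<in> D" "d' \<in> D" "d \<noteq> d'" "z \<in> en d" "z \<in> en d'" for d d' z
      using f that unfolding proper_11_3_def by blast
    have side: "en d \<subseteq> A \<or> en d \<inter> A = {}" if d: "d \<in> D" for d
    proof -
      have dE: "d \<in> E" "d \<notin> G.cut A" using d A by (auto simp: D_def)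
      obtain s t where st: "en d = {s, t}" "s \<noteq> t" using G.ends_obtain[OF dE(1)] .
      have "card (en d \<inter> A) \<noteq> 1" using dE by (simp add: G.cut_def)
      then show ?thesis using st by (auto simp: Int_insert_left split: if_splits)
    qed
    \<comment> \<open>Besides \<open>b\<close>, at most two edges meet at \<open>z\<close>, and they
      have compatible colours, so \<open>third_color\<close> provides a colour for \<open>b\<close>
      as seen from this end.\<close>
    have free: "\<exists>i\<le>10. \<forall>d\<in>D. z \<in> en d \<longrightarrow> apart (f d) i" if z: "z \<in> en b" for z
    proof -
      have "card {d \<in> D. z \<in> en d} \<le> 2"
      proof -
        have "{d \<in> D. z \<in> en d} = {d \<in> E. z \<in> en d} - {b}" by (auto simp: D_def)
        then show ?thesis using G.degree_le[of z] z b(1) G.finite_E by (simp add: card_Diff_singleton)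
      qed
      then consider "card {d \<in> D. z \<in> en d} = 0" | "card {d \<in> D. z \<in> en d} = 1" | "card {d \<in> D. z \<in> en d} = 2"
        by linarith
      then show ?thesis
      proof cases
        case 1
        then have "{d \<in> D. z \<in> en d} = {}" using finD by simp
        then show ?thesis by blast
      next
        case 2
        then obtain d where d: "{d \<in> D. z \<in> en d} = {d}" by (auto simp: card_1_singleton_iff)
        have only: "e = d" if "e \<in> D" "z \<in> en e" for e
        proof -
          have "e \<in> {d \<in> D. z \<in> en d}" using that by simp
          then show ?thesis unfolding d by simp
        qed
        have "d \<in> D" using d by blast
        then obtain i where "i \<le> 10" "apart (f d) i" using third_color[of "f d" "f d"] fle by blast
        then show ?thesis using only by blast
      next
        case 3
        then obtain d d' where d: "{d \<in> D. z \<in> en d} = {d, d'}" "d \<noteq> d'" by (auto simp: card_2_iff)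
        have only: "e = d \<or> e = d'" if "e \<in> D" "z \<in> en e" for e
        proof -
          have "e \<in> {d \<in> D. z \<in> en d}" using that by simp
          then show ?thesis unfolding d(1) by simp
        qed
        have dd: "d \<in> D" "z \<in> en d" "d' \<in> D" "z \<in> en d'" using d(1) by blast+
        then have "apart (f d) (f d')" using fap d(2) by blast
        then obtain i where "i \<le> 10" "apart (f d) i" "apart (f d') i"
          using third_color[OF fle[OF dd(1)] fle[OF dd(3)]] by blast
        then show ?thesis using only by blast
      qed
    qed
    obtain i where i: "i \<le> 10" "\<And>d. d \<in> D \<Longrightarrow> x \<in> en d \<Longrightarrow> apart (f d) i" using free[of x] y by blast
    obtain j where j: "j \<le> 10" "\<And>d. d \<in> D \<Longrightarrow> y \<in> en d \<Longrightarrow> apart (f d) j" using free[of y] y by blast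
    \<comment> \<open>\<open>k\<close> is \<open>j - i\<close> modulo 11: the rotation turns the
      colour that suits \<open>b\<close> at \<open>x\<close> into the one that suits it at
      \<open>y\<close>.\<close>
    define k where "k = (if i \<le> j then j - i else j + 11 - i)"
    have k: "k \<le> 10" "rotate_color k i = j" using i(1) j(1) by (auto simp: k_def rotate_color_def)
    define g where "g d = (if d = b then j else if en d \<subseteq> A then rotate_color k (f d) else f d)" for d
    have gb: "apart (g d) (g b)" if d: "d \<in> D" "z \<in> en d" "z \<in> en b" for d z
    proof -
      have db: "d \<noteq> b" using d(1) by (simp add: D_def)
      consider "z = x" | "z = y" using d(3) y by blast
      then show ?thesis
      proof cases
        case 1
        then have "en d \<subseteq> A" using side[OF d(1)] d(2) xA by blast
        moreover have "apart (rotate_color k (f d)) (rotate_color k i)"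
          using apart_rotate_color[OF k(1) fle[OF d(1)] i(1) i(2)] d 1 by blast
        ultimately show ?thesis using db k(2) by (simp add: g_def)
      next
        case 2
        then have "\<not> en d \<subseteq> A" using d(2) yA by blast
        then show ?thesis using j(2)[of d] d 2 db by (simp add: g_def)
      qed
    qed
    have gD: "apart (g d) (g d')" if d: "d \<in> D" "d' \<in> D" "d \<noteq> d'" "z \<in> en d" "z \<in> en d'" for d d' z
    proof -
      have "d \<noteq> b" "d' \<noteq> b" using d by (auto simp: D_def)
      moreover have "en d \<subseteq> A \<longleftrightarrow> en d' \<subseteq> A" using side[OF d(1)] side[OF d(2)] d(4,5) by blast
      moreover have "apart (f d) (f d')" using fap d by blast
      ultimately show ?thesis
        using apart_rotate_color[OF k(1) fle[OF d(1)] fle[OF d(2)]] by (simp add: g_def)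
    qed
    have "g d \<le> 10" if "d \<in> E" for d
      using that j(1) fle[of d] rotate_color_le[OF k(1)] by (auto simp: g_def D_def)
    moreover have "apart (g d) (g d')" if d: "d \<in> E" "d' \<in> E" "d \<noteq> d'" "en d \<inter> en d' \<noteq> {}" for d d'
    proof -
      obtain z where z: "z \<in> en d" "z \<in> en d'" using d(4) by blast
      consider "d \<in> D" "d' \<in> D" | "d = b" "d' \<in> D" | "d \<in> D" "d' = b" using d by (auto simp: D_def)
      then show ?thesis
      proof cases
        case 1
        then show ?thesis using gD d(3) z by blast
      next
        case 2
        then show ?thesis using gb[of d' z] z apart_commute by simp
      next
        case 3
        then show ?thesis using gb z by blast
      qed
    qed
    ultimately show ?thesis unfolding proper_11_3_def by blast
  qed
qed

section \<open>The edge configurations as subgraphs isomorphic to \<open>H1\<close> and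
  \<open>H2\<close>\<close>

lemma isomorphic_H1:
  assumes d: "distinct [x, y, z]" and e: "distinct [e1, e2, e3, e4]"
    and en: "en e1 = {x, y}" "en e2 = {x, y}" "en e3 = {y, z}" "en e4 = {x, z}"
  shows "isomorphic \<lparr>vertices = {x, y, z}, edge_set = {e1, e2, e3, e4}, ends = en\<rparr> H1"
proof -
  define \<phi> :: "'a \<Rightarrow> nat option" where "\<phi> u = (if u = x then Some 0 else if u = y then Some 1 else None)" for u
  define \<psi> :: "'b \<Rightarrow> nat + nat" where
    "\<psi> f = (if f = e1 then Inl 1 else if f = e2 then Inl 2 else if f = e3 then Inr 1 else Inr 0)" for f
  have \<phi>: "\<phi> x = Some 0" "\<phi> y = Some 1" "\<phi> z = None" using d by (auto simp: \<phi>_def)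
  have \<psi>: "\<psi> e1 = Inl 1" "\<psi> e2 = Inl 2" "\<psi> e3 = Inr 1" "\<psi> e4 = Inr 0" using e by (auto simp: \<psi>_def)
  have "vertices H1 = {None, Some 0, Some 1}" by (auto simp: H1_def subdivide_def K23_def)
  then have "bij_betw \<phi> {x, y, z} (vertices H1)" using \<phi> d by (auto simp: bij_betw_def inj_on_def)
  moreover have "edge_set H1 = {Inl 1, Inl 2, Inr 0, Inr 1}" by (auto simp: H1_def subdivide_def K23_def)
  then have "bij_betw \<psi> {e1, e2, e3, e4} (edge_set H1)" using \<psi> e by (auto simp: bij_betw_def inj_on_def)
  moreover have "\<forall>f\<in>{e1, e2, e3, e4}. ends H1 (\<psi> f) = \<phi> ` en f"
    using en \<phi> \<psi> by (auto simp: H1_def subdivide_def K23_def)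
  ultimately show ?thesis unfolding isomorphic_def by auto
qed

lemma isomorphic_H2:
  assumes d: "distinct [a, b, c, d, w]" and e: "distinct [e1, e2, e3, e4, e5, e6, e7]"
    and en: "en e1 = {a, b}" "en e2 = {b, c}" "en e3 = {c, d}" "en e4 = {a, c}" "en e5 = {b, d}"
      "en e6 = {a, w}" "en e7 = {d, w}"
  shows "isomorphic \<lparr>vertices = {a, b, c, d, w}, edge_set = {e1, e2, e3, e4, e5, e6, e7}, ends = en\<rparr> H2"
proof -
  \<comment> \<open>The edge of \<open>K4\<close> that \<open>H2\<close> subdivides joins 0 and 1,
    so these are the images of \<open>a\<close> and \<open>d\<close>.\<close>
  define \<phi> :: "'a \<Rightarrow> nat option" where
    "\<phi> u = (if u = a then Some 0 else if u = d then Some 1 else if u = b then Some 2 else if u = c then Some 3 else None)" for u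
  define \<psi> :: "'b \<Rightarrow> nat set + nat" where
    "\<psi> f = (if f = e1 then Inl {0, 2} else if f = e2 then Inl {2, 3} else if f = e3 then Inl {1, 3}
      else if f = e4 then Inl {0, 3} else if f = e5 then Inl {1, 2} else if f = e6 then Inr 0 else Inr 1)" for f
  have \<phi>: "\<phi> a = Some 0" "\<phi> d = Some 1" "\<phi> b = Some 2" "\<phi> c = Some 3" "\<phi> w = None"
    using d by (auto simp: \<phi>_def)
  have \<psi>: "\<psi> e1 = Inl {0, 2}" "\<psi> e2 = Inl {2, 3}" "\<psi> e3 = Inl {1, 3}" "\<psi> e4 = Inl {0, 3}"
    "\<psi> e5 = Inl {1, 2}" "\<psi> e6 = Inr 0" "\<psi> e7 = Inr 1"
    using e by (auto simp: \<psi>_def)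
  have K4: "edge_set K4 = {{0, 1}, {0, 2}, {0, 3}, {1, 2}, {1, 3}, {2, 3}}"
  proof (intro equalityI subsetI)
    fix f assume "f \<in> edge_set K4"
    then have f: "f \<subseteq> {0, 1, 2, 3}" "card f = 2" by (auto simp: K4_def)
    then obtain s t where "f = {s, t}" "s \<noteq> t" by (auto simp: card_2_iff)
    moreover from this f have "s \<in> {0, 1, 2, 3}" "t \<in> {0, 1, 2, 3}" by auto
    ultimately show "f \<in> {{0, 1}, {0, 2}, {0, 3}, {1, 2}, {1, 3}, {2, 3}}"
      by (auto simp: insert_commute)
  qed (auto simp: K4_def)
  have ne: "{0, 2} \<noteq> {2, 3::nat}" "{0, 2} \<noteq> {1, 3::nat}" "{0, 2} \<noteq> {0, 3::nat}" "{0, 2} \<noteq> {1, 2::nat}"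
    "{2, 3} \<noteq> {1, 3::nat}" "{2, 3} \<noteq> {0, 3::nat}" "{2, 3} \<noteq> {1, 2::nat}" "{1, 3} \<noteq> {0, 3::nat}"
    "{1, 3} \<noteq> {1, 2::nat}" "{0, 3} \<noteq> {1, 2::nat}" "{0, 2} \<noteq> {0, 1::nat}" "{2, 3} \<noteq> {0, 1::nat}"
    "{1, 3} \<noteq> {0, 1::nat}" "{0, 3} \<noteq> {0, 1::nat}" "{1, 2} \<noteq> {0, 1::nat}"
    by (simp_all add: doubleton_eq_iff)
  have "vertices H2 = {None, Some 0, Some 1, Some 2, Some 3}" by (auto simp: H2_def subdivide_def K4_def)
  then have bij\<phi>: "bij_betw \<phi> {a, b, c, d, w} (vertices H2)" using \<phi> d by (auto simp: bij_betw_def inj_on_def)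
  have H2: "edge_set H2 = {Inr 0, Inr 1, Inl {0, 2}, Inl {0, 3}, Inl {1, 2}, Inl {1, 3}, Inl {2, 3}}"
  proof -
    have "edge_set K4 - {{0, 1}} = {{0, 2}, {0, 3}, {1, 2}, {1, 3}, {2, 3}}"
      unfolding K4 by (simp only: insert_Diff_if ne singleton_iff if_True if_False 
        empty_Diff simp_thms)
    moreover have "ends K4 {0, 1} = {0, 1}" by (simp add: K4_def)
    ultimately show ?thesis unfolding H2_def subdivide_def by simp
  qed
  have "inj_on \<psi> {e1, e2, e3, e4, e5, e6, e7}" using e by (simp add: \<psi> doubleton_eq_iff)
  moreover have "\<psi> ` {e1, e2, e3, e4, e5, e6, e7} = edge_set H2"
    unfolding H2 by (simp only: image_insert image_empty \<psi>) blast
  ultimately have "bij_betw \<psi> {e1, e2, e3, e4, e5, e6, e7} (edge_set H2)"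
    unfolding bij_betw_def by (rule conjI)
  moreover have "\<forall>f\<in>{e1, e2, e3, e4, e5, e6, e7}. ends H2 (\<psi> f) = \<phi> ` en f"
    using en \<phi> \<psi> by (auto simp: H2_def subdivide_def K4_def)
  ultimately show ?thesis using bij\<phi> unfolding isomorphic_def by auto
qed

context multigraph
begin

lemma subgraph_of_edges:
  assumes "D \<subseteq> edge_set G" "\<And>e. e \<in> D \<Longrightarrow> ends G e \<subseteq> W" "W \<subseteq> vertices G"
  shows "is_subgraph \<lparr>vertices = W, edge_set = D, ends = ends G\<rparr> G"
proof -
  have "finite W" "finite D" using assms finite_vertices finite_edge_set finite_subset by blast+
  then show ?thesis
    unfolding is_subgraph_def multigraph_def using assms card_ends by auto
qed

lemma contains_H1:
  assumes "has_H1 (edge_set G) (ends G)" shows "contains_subgraph G H1"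
proof -
  obtain x y z e1 e2 e3 e4 where d: "distinct [x, y, z]" and E: "{e1, e2, e3, e4} \<subseteq> edge_set G" and ne: "e1 \<noteq> e2"
    and en: "ends G e1 = {x, y}" "ends G e2 = {x, y}" "ends G e3 = {y, z}" "ends G e4 = {x, z}"
    using assms unfolding has_H1_def by (elim exE conjE) (rule that)
  have "{x, y, z} \<subseteq> vertices G" using ends_subset[of e1] ends_subset[of e3] E en by auto
  then have "is_subgraph \<lparr>vertices = {x, y, z}, edge_set = {e1, e2, e3, e4}, ends = ends G\<rparr> G"
    using E en by (intro subgraph_of_edges) auto
  moreover have "distinct [e1, e2, e3, e4]" using d ne en by (auto simp: doubleton_eq_iff)
  then have "isomorphic \<lparr>vertices = {x, y, z}, edge_set = {e1, e2, e3, e4}, ends = ends G\<rparr> H1"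
    using d en by (intro isomorphic_H1)
  ultimately show ?thesis unfolding contains_subgraph_def by blast
qed

lemma contains_H2:
  assumes "has_H2 (edge_set G) (ends G)" shows "contains_subgraph G H2"
proof -
  obtain a b c d w e1 e2 e3 e4 e5 e6 e7 where dist: "distinct [a, b, c, d, w]"
    and E: "{e1, e2, e3, e4, e5, e6, e7} \<subseteq> edge_set G"
    and en: "ends G e1 = {a, b}" "ends G e2 = {b, c}" "ends G e3 = {c, d}" "ends G e4 = {a, c}" "ends G e5 = {b, d}"
      "ends G e6 = {a, w}" "ends G e7 = {d, w}"
    using assms unfolding has_H2_def by (elim exE conjE) (rule that)
  have "{a, b, c, d, w} \<subseteq> vertices G" using ends_subset[of e1] ends_subset[of e3] ends_subset[of e6] E en by auto
  then have "is_subgraph \<lparr>vertices = {a, b, c, d, w}, edge_set = {e1, e2, e3, e4, e5, e6, e7}, ends = ends G\<rparr> G"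
    using E en by (intro subgraph_of_edges) auto
  moreover have "distinct [e1, e2, e3, e4, e5, e6, e7]" using dist en by (auto simp: doubleton_eq_iff)
  then have "isomorphic \<lparr>vertices = {a, b, c, d, w}, edge_set = {e1, e2, e3, e4, e5, e6, e7}, ends = ends G\<rparr> H2"
    using dist en by (intro isomorphic_H2)
  ultimately show ?thesis unfolding contains_subgraph_def by blast
qed

lemma subcubic_edges:
  assumes "max_degree G \<le> 3" shows "subcubic (edge_set G) (ends G)"
proof
  fix v
  show "card {e \<in> edge_set G. v \<in> ends G e} \<le> 3"
  proof (cases "v \<in> vertices G")
    case True
    then have "vertex_degree G v \<le> max_degree G"
      unfolding max_degree_def using finite_vertices by (intro cSUP_upper) auto
    then show ?thesis using assms by (simp add: vertex_degree_def)
  next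
    case False
    then have "{e \<in> edge_set G. v \<in> ends G e} = {}" using ends_subset by blast
    then show ?thesis by (simp only: card.empty)
  qed
qed (use finite_edge_set card_ends in auto)

end

lemma circular_chromatic_index_le:
  assumes "proper_11_3 (edge_set G) (ends G) f"
  shows "circular_chromatic_index G \<le> 11 / 3"
proof -
  have col: "pq_coloring (line_graph G) 11 3 f"
    unfolding pq_coloring_def
  proof (intro conjI ballI allI impI)
    fix e assume "e \<in> vertices (line_graph G)"
    then have "f e \<le> 10" using assms by (simp add: line_graph_def proper_11_3_def)
    then show "f e \<in> {0..<11}" by simp
  next
    fix a x y assume a: "a \<in> edge_set (line_graph G)" "ends (line_graph G) a = {x, y}"
    then obtain e g where eg: "{x, y} = {e, g}" "e \<in> edge_set G" "g \<in> edge_set G" "e \<noteq> g" "ends G e \<inter> ends G g \<noteq> {}"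
      by (auto simp: line_graph_def)
    then have "apart (f e) (f g)" using assms unfolding proper_11_3_def by blast
    then have "apart (f x) (f y)" using eg(1) apart_commute by (auto simp: doubleton_eq_iff)
    then show "int 3 \<le> \<bar>int (f x) - int (f y)\<bar>" "\<bar>int (f x) - int (f y)\<bar> \<le> int 11 - int 3"
      by (simp_all add: apart_def)
  qed
  show ?thesis
    unfolding circular_chromatic_index_def circular_chromatic_number_def
  proof (rule cInf_lower)
    have "(11::real) / 3 = real 11 / real 3 \<and> 0 < (3::nat) \<and> (3::nat) \<le> 11 \<and> (\<exists>f. pq_coloring (line_graph G) 11 3 f)"
      using col by auto
    then show "(11::real) / 3 \<in> {real p / real q | p q. 0 < q \<and> q \<le> p \<and> (\<exists>f. pq_coloring (line_graph G) p q f)}"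
      by blast
    show "bdd_below {real p / real q | p q. 0 < q \<and> q \<le> p \<and> (\<exists>f. pq_coloring (line_graph G) p q f)}"
      by (rule bdd_belowI[of _ 0]) auto
  qed
qed

theorem theorem1p5:
  fixes G :: "('v, 'e) mgraph"
  assumes "multigraph G"
    and "max_degree G = 3"
    and "\<not> contains_subgraph G H1"
    and "\<not> contains_subgraph G H2"
  shows "circular_chromatic_index G \<le> 11 / 3"
proof -
  interpret multigraph G by (rule assms(1))
  obtain f where "proper_11_3 (edge_set G) (ends G) f"
    using subcubic_coloring[OF subcubic_edges] contains_H1 contains_H2 assms(2-4) by auto
  then show ?thesis by (rule circular_chromatic_index_le)
qed

end
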